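(* Let $\lambda>0$, let $k=\begin{pmatrix}A&B\\C&D\end{pmatrix}\in S$, and let $A_k$ be a unitary operator on $\mathcal F_\lambda$ with integral kernel $b_k(z,w)$. Then $A_k$ satisfies the relation $$d\rho(k\cdot X)A_k=A_k\,d\rho(X)\qquad\text{for each }X\in\mathfrak h_n$$ if and only if $b_k(z,w)$ satisfies $$\frac\lambda2\,(Cu+Dv)^tz\;b_k(z,w)-\sum_{j=1}^n(Au+Bv)_j\frac{\partial}{\partial z_j}b_k(z,w)=-\frac\lambda2\,u^t\bar w\;b_k(z,w)+\sum_{j=1}^nv_j\frac{\partial}{\partial\bar w_j}b_k(z,w)$$ for all $u,v,z,w\in\mathbb C^n$.
   Context: Let $n\ge1$. Elements of $\mathbb C^n$ are column vectors and $u^tz=\sum_ju_jz_j$ (bilinear, no conjugation). Let $\omega((z,w),(z',w'))=\frac i2(z^tw'-z'^tw)$. The Heisenberg group is $H_n=\{((z,\bar z),c): z\in\mathbb C^n,c\in\mathbb R\}$ with product $((z,\bar z),c)\cdot((z',\bar z'),c')=((z+z',\bar z+\bar z'),c+c'+\frac12\omega((z,\bar z),(z',\bar z')))$. Its Lie algebra is $\mathfrak h_n=\{[(z,\bar z),c]:z\in\mathbb C^n,c\in\mathbb R\}$, with complexification $\mathfrak h_n^c=\{[(u,v),c]:u,v\in\mathbb C^n,c\in\mathbb C\}$ and $\exp[(z,\bar z),c]=((z,\bar z),c)$. $S$ is the group of complex $2n\times2n$ matrices of the form $\begin{pmatrix}P&Q\\\bar Q&\bar P\end{pmatrix}$ ($P,Q$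 of size $n\times n$) which satisfy $M^tJM=J$ with $J=\begin{pmatrix}0&I_n\\-I_n&0\end{pmatrix}$. It acts on $\mathfrak h_n$ (and complex-linearly on $\mathfrak h_n^c$) by $\begin{pmatrix}A&B\\C&D\end{pmatrix}\cdot[(u,v),c]=[(Au+Bv,Cu+Dv),c]$. $\mathcal F_\lambda$ is the Hilbert space of holomorphic $f$ on $\mathbb C^n$ with $\|f\|^2=\int|f(z)|^2e^{-\lambda|z|^2/2}\,d\mu_\lambda(z)<\infty$, $d\mu_\lambda(z)=(2\pi)^{-n}\lambda^n\,dm(z)$, $dm$ Lebesgue measure. The representation $\rho=\rho_\lambda$ of $H_n$ on $\mathcal F_\lambda$ is $(\rho(h)f)(z)=\exp(i\lambda c_0+\frac\lambda2\bar z_0^tz-\frac\lambda4|z_0|^2)f(z-z_0)$ for $h=((z_0,\bar z_0),c_0)$, with differential (extended complex-linearly) $(d\rho([(u,v),c])f)(z)=(i\lambda c+\frac\lambda2v^tz)f(z)-\sum_ju_j\frac{\partial f}{\partial z_j}(z)$. The operator relation is understood as an equality of functions after application to every smooth vector $f$ of $\rho$ (i.e. $h\mapsto\rho(h)f$ is smooth into $\mathcal F_\lambda$), $d\rho(k\cdot X)$ acting as a differential operator on the holomorphic function $A_kf$. With $e_z(w)=\exp(\lambda\bar z^tw/2)$, the integral kernel of a bounded operator $A$ on $\mathcal F_\lambda$ is $k_A(z,w)=\langle Ae_w,e_z\rangle_{\mathcal F_\lambda}=(Ae_w)(z)$, holomorphic in $z$ and antiholomorphic in $w$; it satisfies $(Af)(z)=\int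 k_A(z,w)f(w)e^{-\lambda|w|^2/2}\,d\mu_\lambda(w)$. *)

theory Defs
  imports "HOL-Analysis.Analysis"
begin

text \<open>The index type \<open>'n\<close> plays the role of \<open>{1,...,n}\<close>, so \<open>complex ^ 'n\<close> is complex \<open>n\<close>-space and
  \<open>scalar_product u z\<close> is the bilinear expression \<open>u\<^sup>t z\<close> (no conjugation).\<close>

definition vcnj :: "complex ^ 'n \<Rightarrow> complex ^ 'n" where
  "vcnj z = (\<chi> i. cnj (z $ i))"

text \<open>Elements \<open>((z, cnj z), c)\<close> of the Heisenberg group, written in the global chart \<open>(z, c)\<close>; the group
  is the range of this map and carries the smooth structure of the chart.\<close>

definition heis :: "(complex ^ 'n) \<times> real \<Rightarrow> ((complex ^ 'n) \<times> (complex ^ 'n)) \<times> real" where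
  "heis = (\<lambda>(z, c). ((z, vcnj z), c))"

type_synonym 'n heis_lie_c = "((complex ^ 'n) \<times> (complex ^ 'n)) \<times> complex"

text \<open>The real Lie algebra, as a subset of its complexification \<open>'n heis_lie_c\<close>.\<close>

definition heis_lie :: "('n::finite heis_lie_c) set" where
  "heis_lie = {((z, vcnj z), complex_of_real c) | z c. True}"

text \<open>\<open>2n \<times> 2n\<close> matrices are indexed by the sum type: \<open>Inl\<close> indices come first, then \<open>Inr\<close> indices.\<close>

definition block_matrix ::
  "complex ^ 'n ^ 'n \<Rightarrow> complex ^ 'n ^ 'n \<Rightarrow> complex ^ 'n ^ 'n \<Rightarrow> complex ^ 'n ^ 'n
     \<Rightarrow> complex ^ ('n + 'n) ^ ('n + 'n)" where
  "block_matrix A B C D = (\<chi> i j. case i of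
       Inl p \<Rightarrow> (case j of Inl q \<Rightarrow> A $ p $ q | Inr q \<Rightarrow> B $ p $ q)
     | Inr p \<Rightarrow> (case j of Inl q \<Rightarrow> C $ p $ q | Inr q \<Rightarrow> D $ p $ q))"

definition J_matrix :: "complex ^ ('n::finite + 'n) ^ ('n + 'n)" where
  "J_matrix = block_matrix 0 (mat 1) (- mat 1) 0"

definition S_group :: "(complex ^ ('n::finite + 'n) ^ ('n + 'n)) set" where
  "S_group = {M. (\<exists>P Q. M = block_matrix P Q (map_matrix cnj Q) (map_matrix cnj P))
                 \<and> transpose M ** J_matrix ** M = J_matrix}"

definition act :: "complex ^ ('n::finite + 'n) ^ ('n + 'n) \<Rightarrow> 'n heis_lie_c \<Rightarrow> 'n heis_lie_c" where
  "act M = (\<lambda>((u, v), c).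
     let y = M *v (\<chi> i. case i of Inl p \<Rightarrow> u $ p | Inr p \<Rightarrow> v $ p)
     in (((\<chi> p. y $ Inl p), (\<chi> p. y $ Inr p)), c))"

lemma act_block_matrix:
  "act (block_matrix A B C D) ((u, v), c) = ((A *v u + B *v v, C *v u + D *v v), c)"
proof -
  have split: "(\<Sum>i\<in>UNIV. g i) = (\<Sum>p\<in>UNIV. g (Inl p)) + (\<Sum>p\<in>UNIV. g (Inr p))"
    for g :: "'b::finite + 'b \<Rightarrow> complex"
    unfolding UNIV_Plus_UNIV[symmetric] by (subst sum.Plus) auto
  show ?thesis
    by (simp add: act_def Let_def vec_eq_iff matrix_vector_mult_def block_matrix_def split)
qed

definition holomorphic_Cn :: "(complex ^ 'n \<Rightarrow> complex) \<Rightarrow> bool" where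
  "holomorphic_Cn f \<longleftrightarrow> (\<forall>z. \<exists>d. (f has_derivative (\<lambda>h. scalar_product d h)) (at z))"

text \<open>\<open>lborel\<close> on \<open>complex ^ 'n\<close> is Lebesgue measure on real \<open>2n\<close>-space.\<close>

definition mu :: "real \<Rightarrow> (complex ^ 'n) measure" where
  "mu lam = density lborel (\<lambda>_. ennreal (lam ^ CARD('n) / (2 * pi) ^ CARD('n)))"

definition fock :: "real \<Rightarrow> (complex ^ 'n \<Rightarrow> complex) set" where
  "fock lam = {f. holomorphic_Cn f \<and>
     integrable (mu lam) (\<lambda>z. (cmod (f z))\<^sup>2 * exp (- lam * (norm z)\<^sup>2 / 2))}"

definition fock_norm :: "real \<Rightarrow> (complex ^ 'n \<Rightarrow> complex) \<Rightarrow> real" where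
  "fock_norm lam f = sqrt (LINT z|mu lam. (cmod (f z))\<^sup>2 * exp (- lam * (norm z)\<^sup>2 / 2))"

definition fock_inner ::
  "real \<Rightarrow> (complex ^ 'n \<Rightarrow> complex) \<Rightarrow> (complex ^ 'n \<Rightarrow> complex) \<Rightarrow> complex" where
  "fock_inner lam f g =
     (LINT z|mu lam. f z * cnj (g z) * complex_of_real (exp (- lam * (norm z)\<^sup>2 / 2)))"

text \<open>Operators on the Fock space are total functions; only their values on \<open>fock lam\<close> matter.\<close>

definition fock_unitary ::
  "real \<Rightarrow> ((complex ^ 'n \<Rightarrow> complex) \<Rightarrow> (complex ^ 'n \<Rightarrow> complex)) \<Rightarrow> bool" where
  "fock_unitary lam T \<longleftrightarrow>
     T ` fock lam = fock lam \<and>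
     (\<forall>f\<in>fock lam. \<forall>g\<in>fock lam. \<forall>a b. T (\<lambda>z. a * f z + b * g z) = (\<lambda>z. a * T f z + b * T g z)) \<and>
     (\<forall>f\<in>fock lam. \<forall>g\<in>fock lam. fock_inner lam (T f) (T g) = fock_inner lam f g)"

definition coherent :: "real \<Rightarrow> complex ^ 'n \<Rightarrow> complex ^ 'n \<Rightarrow> complex" where
  "coherent lam z = (\<lambda>w. exp (complex_of_real lam * scalar_product (vcnj z) w / 2))"

definition integral_kernel ::
  "real \<Rightarrow> ((complex ^ 'n \<Rightarrow> complex) \<Rightarrow> (complex ^ 'n \<Rightarrow> complex))
     \<Rightarrow> complex ^ 'n \<Rightarrow> complex ^ 'n \<Rightarrow> complex" where
  "integral_kernel lam T z w = fock_inner lam (T (coherent lam w)) (coherent lam z)"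

definition partial_re :: "'n \<Rightarrow> (complex ^ 'n \<Rightarrow> complex) \<Rightarrow> complex ^ 'n \<Rightarrow> complex" where
  "partial_re j f z = vector_derivative (\<lambda>t. f (z + t *\<^sub>R axis j 1)) (at 0)"

definition partial_im :: "'n \<Rightarrow> (complex ^ 'n \<Rightarrow> complex) \<Rightarrow> complex ^ 'n \<Rightarrow> complex" where
  "partial_im j f z = vector_derivative (\<lambda>t. f (z + t *\<^sub>R axis j \<i>)) (at 0)"

definition wirtinger :: "'n \<Rightarrow> (complex ^ 'n \<Rightarrow> complex) \<Rightarrow> complex ^ 'n \<Rightarrow> complex" where
  "wirtinger j f z = (partial_re j f z - \<i> * partial_im j f z) / 2"

definition wirtinger_bar :: "'n \<Rightarrow> (complex ^ 'n \<Rightarrow> complex) \<Rightarrow> complex ^ 'n \<Rightarrow> complex" where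
  "wirtinger_bar j f z = (partial_re j f z + \<i> * partial_im j f z) / 2"

definition rho ::
  "real \<Rightarrow> ((complex ^ 'n) \<times> (complex ^ 'n)) \<times> real
     \<Rightarrow> (complex ^ 'n \<Rightarrow> complex) \<Rightarrow> (complex ^ 'n \<Rightarrow> complex)" where
  "rho lam = (\<lambda>((z0, z0bar), c0) f z.
     exp (\<i> * complex_of_real lam * complex_of_real c0
          + complex_of_real lam / 2 * scalar_product z0bar z
          - complex_of_real (lam / 4 * (norm z0)\<^sup>2)) * f (z - z0))"

definition drho ::
  "real \<Rightarrow> 'n::finite heis_lie_c \<Rightarrow> (complex ^ 'n \<Rightarrow> complex) \<Rightarrow> (complex ^ 'n \<Rightarrow> complex)" where
  "drho lam = (\<lambda>((u, v), c) f z.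
     (\<i> * complex_of_real lam * c + complex_of_real lam / 2 * scalar_product v z) * f z
     - (\<Sum>j\<in>UNIV. u $ j * wirtinger j f z))"

text \<open>Smoothness of maps from a Euclidean space into the Fock space. As the Fock space is a set of
  functions and not a type, Frechet differentiability with respect to \<open>fock_norm\<close> is spelled out.
  On a finite-dimensional domain, a differentiable map is \<open>C\<^sup>k\<^sup>+\<^sup>1\<close> iff all its directional
  derivatives \<open>\<lambda>x. D x h\<close> are \<open>C\<^sup>k\<close>.\<close>

definition fock_has_derivative ::
  "real \<Rightarrow> ('a::euclidean_space \<Rightarrow> complex ^ 'n \<Rightarrow> complex) \<Rightarrow> ('a \<Rightarrow> complex ^ 'n \<Rightarrow> complex)
     \<Rightarrow> 'a \<Rightarrow> bool" where
  "fock_has_derivative lam \<phi> D x \<longleftrightarrow>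
     (\<forall>h. D h \<in> fock lam) \<and>
     (\<forall>z. linear (\<lambda>h. D h z)) \<and>
     ((\<lambda>y. fock_norm lam (\<lambda>z. \<phi> y z - \<phi> x z - D (y - x) z) / norm (y - x)) \<longlongrightarrow> 0) (at x)"

primrec fock_Ck ::
  "real \<Rightarrow> nat \<Rightarrow> ('a::euclidean_space \<Rightarrow> complex ^ 'n \<Rightarrow> complex) \<Rightarrow> bool" where
  "fock_Ck lam 0 \<phi> \<longleftrightarrow>
     (\<forall>x. \<phi> x \<in> fock lam \<and> ((\<lambda>y. fock_norm lam (\<lambda>z. \<phi> y z - \<phi> x z)) \<longlongrightarrow> 0) (at x))"
| "fock_Ck lam (Suc k) \<phi> \<longleftrightarrow>
     (\<forall>x. \<phi> x \<in> fock lam) \<and>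
     (\<exists>D. (\<forall>x. fock_has_derivative lam \<phi> (D x) x) \<and> (\<forall>h. fock_Ck lam k (\<lambda>x. D x h)))"

definition smooth_vectors :: "real \<Rightarrow> (complex ^ 'n \<Rightarrow> complex) set" where
  "smooth_vectors lam = {f \<in> fock lam. \<forall>k. fock_Ck lam k (\<lambda>x. rho lam (heis x) f)}"

end

theory Submission
  imports Defs "HOL-Probability.Distributions" "HOL-Complex_Analysis.Complex_Analysis"
begin

text \<open>Up to a positive constant, \<open>b\<^sub>k(z,w)\<close> is \<open>(A\<^sub>k e\<^sub>w)(z)\<close>, and \<open>d\<rho>(X) e\<^sub>w\<close> combines \<open>e\<^sub>w\<close> with
  the derivative of \<open>e\<^sub>w\<close> in \<open>w\<close>. So the differential equation for the kernel is the operator relation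
  applied to coherent states, extended from the real form \<open>v = cnj u\<close> to all \<open>u, v\<close> by complex linearity.
  One direction then only needs that coherent states are smooth vectors. For the other one, the equation
  says that the derivative of \<open>t \<mapsto> \<langle>A\<^sub>k \<rho>(exp tX) e\<^sub>w, \<rho>(exp t(k\<cdot>X)) e\<^sub>z\<rangle>\<close> vanishes at \<open>0\<close>, hence everywhere
  since \<open>\<rho>\<close> permutes the lines spanned by coherent states. This gives
  \<open>A\<^sub>k \<rho>(exp tX) = \<rho>(exp t(k\<cdot>X)) A\<^sub>k\<close> on coherent states and, by unitarity and the reproducing property,
  on the whole space. Differentiating it on smooth vectors at \<open>t = 0\<close> gives the relation.\<close>

subsection \<open>Gaussian measure and the mean value property\<close>

text \<open>The operators \<open>drho lam X\<close> are unbounded. Approximating a smooth vector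
  \<open>f\<close> in norm by combinations of coherent states therefore gives no control over
  \<open>drho lam X f\<close>, and the relation cannot be extended from coherent states directly.
  The one-parameter groups consist of unitary operators, so at that level the identity does extend.
  The way back to \<open>f\<close> rests on three facts: the orbit of a smooth vector is
  differentiable in the Fock norm, a linear isometry preserves norm derivatives, and point
  evaluation is a multiple of the inner product with a coherent state. The last fact turns a norm
  derivative into a pointwise one, which is the differential operator \<open>drho\<close>. It also
  makes coherent states separate points, which here takes the place of a density argument. The
  central coordinate of \<open>X\<close> contributes the same scalar on both sides, so the work
  concerns \<open>X = ((a, cnj a), 0)\<close>.\<close>

lemma nn_integral_lborel_translate:
  fixes a :: "'a::euclidean_space"
  assumes [measurable]: "f \<in> borel_measurable borel"
  shows "(\<integral>\<^sup>+x. f (x + a) \<partial>lborel) = (\<integral>\<^sup>+x. f x \<partial>lborel)"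
proof -
  have "(\<integral>\<^sup>+x. f x \<partial>lborel) = (\<integral>\<^sup>+x. f x \<partial>distr lborel borel ((+) a))"
    by (simp add: lborel_distr_plus)
  also have "\<dots> = (\<integral>\<^sup>+x. f (x + a) \<partial>lborel)"
    by (simp add: nn_integral_distr add.commute)
  finally show ?thesis ..
qed

lemma integrable_exp_neg_square:
  fixes c :: real
  assumes "c > 0"
  shows "integrable lborel (\<lambda>x::real. exp (- c * x\<^sup>2))"
proof -
  \<comment> \<open>The variance 1/(2c) makes the exponent of the normal density equal to -c
    x^2.\<close>
  define s where "s = sqrt (1 / (2 * c))"
  have s: "s\<^sup>2 = 1 / (2 * c)" "s > 0" using assms by (auto simp: s_def)
  have "integrable lborel (\<lambda>x. sqrt (2 * pi * s\<^sup>2) * normal_density 0 s x)"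
    by (intro integrable_mult_right integrable_normal_density s)
  also have "(\<lambda>x. sqrt (2 * pi * s\<^sup>2) * normal_density 0 s x) = (\<lambda>x. exp (- c * x\<^sup>2))"
    using assms s by (auto simp: normal_density_def fun_eq_iff field_simps)
  finally show ?thesis .
qed

text \<open>The Gaussian is a product over the coordinates, so its integral is a power of the
  one-dimensional one.\<close>

lemma nn_integral_gaussian_finite:
  fixes c :: real
  assumes c: "c > 0"
  shows "(\<integral>\<^sup>+x. ennreal (exp (- c * (norm (x :: 'a::euclidean_space))\<^sup>2)) \<partial>lborel) < \<infinity>"
proof -
  have eq: "exp (- c * (norm x)\<^sup>2) = (\<Prod>b\<in>Basis. exp (- c * (x \<bullet> b)\<^sup>2))" for x :: 'a
  proof -
    have "- c * (norm x)\<^sup>2 = (\<Sum>b\<in>Basis. - c * (x \<bullet> b)\<^sup>2)"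
      by (subst sum_distrib_left[symmetric])
         (simp only: power2_norm_eq_inner euclidean_inner[of x x], simp only: power2_eq_square)
    then show ?thesis by (simp only: exp_sum finite_Basis)
  qed
  have "(\<integral>\<^sup>+x. ennreal (exp (- c * (norm (x :: 'a))\<^sup>2)) \<partial>lborel)
      = (\<integral>\<^sup>+x. (\<Prod>b\<in>Basis. ennreal (exp (- c * ((x :: 'a) \<bullet> b)\<^sup>2))) \<partial>lborel)"
    by (simp only: eq prod_ennreal exp_ge_zero)
  also have "\<dots> = (\<Prod>b\<in>(Basis::'a set). \<integral>\<^sup>+x. ennreal (exp (- c * x\<^sup>2)) \<partial>lborel)"
    by (rule nn_integral_lborel_prod[where f = "\<lambda>b x. ennreal (exp (- c * x\<^sup>2))"]) auto
  also have "\<dots> < \<infinity>"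
    using integrable_exp_neg_square[OF c]
    by (simp add: real_integrable_def less_top power_less_top_ennreal)
  finally show ?thesis .
qed

lemma integrable_gaussian:
  fixes c :: real
  assumes "c > 0"
  shows "integrable lborel (\<lambda>x::'a::euclidean_space. exp (- c * (norm x)\<^sup>2))"
  using nn_integral_gaussian_finite[OF assms] by (intro integrableI_bounded) auto

text \<open>Uniqueness of Haar measure: for a translation invariant \<open>M\<close>, computing
  \<open>\<integral>\<integral> g(y) 1\<^sub>A(x + y) dM(x) dy\<close> in both orders gives \<open>M(A) \<integral>g = lborel(A) \<integral>g(-x) dM(x)\<close>. With
  the Gaussian as \<open>g\<close> both factors agree.\<close>

lemma distr_lborel_orthogonal_transformation:
  fixes R :: "'a::euclidean_space \<Rightarrow> 'a"
  assumes R: "orthogonal_transformation R"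
  shows "distr lborel borel R = lborel"
proof (rule measure_eqI)
  show "sets (distr lborel borel R) = sets lborel" by simp
next
  fix A assume "A \<in> sets (distr lborel borel R)"
  then have A[measurable]: "A \<in> sets borel" by simp
  define g :: "'a \<Rightarrow> ennreal" where "g = (\<lambda>y. ennreal (exp (- 1 * (norm y)\<^sup>2)))"
  have [measurable]: "g \<in> borel_measurable borel" by (simp add: g_def)
  have lin: "linear R" using R by (rule orthogonal_transformation_linear)
  have [measurable]: "R \<in> borel_measurable borel"
    using lin linear_continuous_on linear_conv_bounded_linear borel_measurable_continuous_onI by blast
  define R' where "R' = inv R"
  have RR': "R (R' y) = y" for y
    using orthogonal_transformation_surj[OF R] by (simp add: R'_def surj_f_inv_f)
  define c where "c = (\<integral>\<^sup>+y. g y \<partial>lborel)"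
  have cfin: "c < \<infinity>" unfolding c_def g_def by (rule nn_integral_gaussian_finite) simp
  have cpos: "c \<noteq> 0"
  proof
    assume "c = 0"
    then have "AE y in lborel. g y = 0" by (simp add: c_def nn_integral_0_iff_AE)
    then have "AE y::'a in lborel. False" by eventually_elim (simp add: g_def)
    then show False using emeasure_lborel_UNIV[where 'a='a] by (simp add: AE_iff_measurable[OF _ refl])
  qed
  have sym: "(\<integral>\<^sup>+x. g (y - R x) \<partial>lborel) = c" for y
  proof -
    have "norm (y - R x) = norm (x + - R' y)" for x
    proof -
      have "y - R x = R (R' y - x)" using linear_diff[OF lin, of "R' y" x] by (simp add: RR')
      then show ?thesis using orthogonal_transformation_norm[OF R] by (simp add: norm_minus_commute)
    qed
    then have "(\<integral>\<^sup>+x. g (y - R x) \<partial>lborel) = (\<integral>\<^sup>+x. g (x + - R' y) \<partial>lborel)"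
      by (simp add: g_def)
    also have "\<dots> = c" unfolding c_def by (rule nn_integral_lborel_translate) simp
    finally show ?thesis .
  qed
  have "c * emeasure (distr lborel borel R) A = c * (\<integral>\<^sup>+x. indicator A (R x) \<partial>lborel)"
    by (simp add: nn_integral_indicator[symmetric] nn_integral_distr del: nn_integral_indicator)
  also have "\<dots> = (\<integral>\<^sup>+y. g y * (\<integral>\<^sup>+x. indicator A (R x) \<partial>lborel) \<partial>lborel)"
    by (simp add: c_def nn_integral_multc)
  also have "\<dots> = (\<integral>\<^sup>+y. g y * (\<integral>\<^sup>+x. indicator A (R x + y) \<partial>lborel) \<partial>lborel)"
  proof -
    \<comment> \<open>R x + y = R (x + R' y), so translation invariance of \<open>lborel\<close>
      passes to its image under R.\<close>
    have "(\<integral>\<^sup>+x. indicator A (R x) \<partial>lborel) = (\<integral>\<^sup>+x. indicator A (R x + y) \<partial>lborel)" for y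
    proof -
      have "(\<integral>\<^sup>+x. indicator A (R x) \<partial>lborel) = (\<integral>\<^sup>+x. indicator A (R (x + R' y)) \<partial>lborel)"
        by (rule nn_integral_lborel_translate[symmetric]) simp
      then show ?thesis by (simp add: linear_add[OF lin] RR')
    qed
    then show ?thesis by presburger
  qed
  also have "\<dots> = (\<integral>\<^sup>+y. \<integral>\<^sup>+x. g y * indicator A (R x + y) \<partial>lborel \<partial>lborel)"
    by (simp add: nn_integral_cmult)
  also have "\<dots> = (\<integral>\<^sup>+x. \<integral>\<^sup>+y. g y * indicator A (R x + y) \<partial>lborel \<partial>lborel)"
    by (rule lborel_pair.Fubini') simp
  also have "\<dots> = (\<integral>\<^sup>+x. \<integral>\<^sup>+y. g (y - R x) * indicator A y \<partial>lborel \<partial>lborel)"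
  proof -
    have "(\<integral>\<^sup>+y. g y * indicator A (R x + y) \<partial>lborel)
       = (\<integral>\<^sup>+y. g (y - R x) * indicator A y \<partial>lborel)" for x
      using nn_integral_lborel_translate[of "\<lambda>y. g (y - R x) * indicator A y" "R x"]
      by (simp add: add.commute)
    then show ?thesis by simp
  qed
  also have "\<dots> = (\<integral>\<^sup>+y. \<integral>\<^sup>+x. g (y - R x) * indicator A y \<partial>lborel \<partial>lborel)"
    by (rule lborel_pair.Fubini') simp
  also have "\<dots> = (\<integral>\<^sup>+y. c * indicator A y \<partial>lborel)"
    by (simp add: nn_integral_multc sym)
  also have "\<dots> = c * emeasure lborel A"
    by (simp add: nn_integral_cmult_indicator)
  finally show "emeasure (distr lborel borel R) A = emeasure lborel A"
    using cfin cpos by (auto simp: ennreal_mult_cancel_left)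
qed

text \<open>Cauchy's formula at the centre of the unit circle: for u = exp(2 pi i t) the form du/u
  is 2 pi i dt.\<close>

lemma circle_average:
  assumes f: "f holomorphic_on UNIV"
  shows "((\<lambda>t. f (exp (2 * of_real pi * \<i> * of_real t))) has_integral f 0) {0..1}"
proof -
  have "((\<lambda>u. f u / (u - 0)) has_contour_integral (2 * of_real pi * \<i> * f 0)) (circlepath 0 1)"
    using f by (intro Cauchy_integral_circlepath_simple) (auto intro: holomorphic_on_subset)
  then have "((\<lambda>x. f (exp (2 * of_real pi * \<i> * of_real x)) * (2 * of_real pi * \<i>)) has_integral
      2 * of_real pi * \<i> * f 0) {0..1}"
    unfolding has_contour_integral_def
    by (rule has_integral_eq[rotated]) (simp add: vector_derivative_circlepath01, simp add: circlepath mult_ac)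
  then have "((\<lambda>x. f (exp (2 * of_real pi * \<i> * of_real x)) * (2 * of_real pi * \<i>) * (1 / (2 * of_real pi * \<i>)))
      has_integral 2 * of_real pi * \<i> * f 0 * (1 / (2 * of_real pi * \<i>))) {0..1}"
    by (rule has_integral_mult_left)
  then show ?thesis by simp
qed

section \<open>The bilinear pairing and conjugation on complex n-space\<close>

lemma scalar_product_add_right [simp]:
  "scalar_product (a :: complex ^ 'n) (x + y) = scalar_product a x + scalar_product a y"
  by (simp add: scalar_product_def distrib_left sum.distrib)

lemma scalar_product_add_left [simp]:
  "scalar_product (x + y) (a :: complex ^ 'n) = scalar_product x a + scalar_product y a"
  by (simp add: scalar_product_def distrib_right sum.distrib)

lemma scalar_product_diff_right [simp]:
  "scalar_product (a :: complex ^ 'n) (x - y) = scalar_product a x - scalar_product a y"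
  by (simp add: scalar_product_def right_diff_distrib sum_subtractf)

lemma scalar_product_minus_right [simp]: "scalar_product (a :: complex ^ 'n) (- x) = - scalar_product a x"
  by (simp add: scalar_product_def sum_negf)

lemma scalar_product_zero [simp]:
  "scalar_product (a :: complex ^ 'n) 0 = 0" "scalar_product 0 (a :: complex ^ 'n) = 0"
  by (simp_all add: scalar_product_def)

lemma scalar_product_scale [simp]:
  "scalar_product (a :: complex ^ 'n) (c *s x) = c * scalar_product a x"
  "scalar_product (c *s x) (a :: complex ^ 'n) = c * scalar_product x a"
  by (simp_all add: scalar_product_def sum_distrib_left ac_simps)

lemma scalar_product_scaleR [simp]:
  "scalar_product (a :: complex ^ 'n) (r *\<^sub>R x) = of_real r * scalar_product a x"
  "scalar_product (r *\<^sub>R x) (a :: complex ^ 'n) = of_real r * scalar_product x a"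
  unfolding scalar_product_def sum_distrib_left vector_scaleR_component
  by (auto intro!: sum.cong simp: scaleR_conv_of_real)

lemma scalar_product_commute: "scalar_product (a :: complex ^ 'n) b = scalar_product b a"
  by (simp add: scalar_product_def mult.commute)

lemma scalar_product_axis [simp]: "scalar_product (a :: complex ^ 'n) (axis j c) = a $ j * c"
proof -
  have "scalar_product a (axis j c) = (\<Sum>i\<in>UNIV. if i = j then a $ j * c else 0)"
    unfolding scalar_product_def by (rule sum.cong) (auto simp: axis_def)
  then show ?thesis by simp
qed

lemma vcnj_simps [simp]:
  "vcnj (x + y) = vcnj x + vcnj y" "vcnj (x - y) = vcnj x - vcnj y" "vcnj (- x) = - vcnj x"
  "vcnj 0 = 0" "vcnj (r *\<^sub>R x) = r *\<^sub>R vcnj x" "vcnj (c *s x) = cnj c *s vcnj x"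
  "vcnj (vcnj x) = x" "vcnj x $ i = cnj (x $ i)"
  by (simp_all add: vcnj_def vec_eq_iff)

lemma cnj_scalar_product [simp]: "cnj (scalar_product x y) = scalar_product (vcnj x) (vcnj y)"
  by (simp add: scalar_product_def)

lemma Re_scalar_product_vcnj: "Re (scalar_product (vcnj a) z) = a \<bullet> z"
  by (simp add: scalar_product_def inner_vec_def inner_complex_def)

lemma scalar_product_vcnj_self: "scalar_product (vcnj u) u = complex_of_real ((norm u)\<^sup>2)"
proof -
  have "(norm u)\<^sup>2 = (\<Sum>i\<in>UNIV. (cmod (u $ i))\<^sup>2)"
    by (simp add: norm_vec_def L2_set_def sum_nonneg)
  then show ?thesis
    by (simp only: scalar_product_def of_real_sum complex_norm_square vcnj_simps mult.commute)
qed

lemma norm_scalar_product_le: "cmod (scalar_product a z) \<le> norm a * norm z" for a z :: "complex ^ 'n"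
proof -
  have "cmod (scalar_product a z) \<le> (\<Sum>i\<in>UNIV. cmod (a $ i) * cmod (z $ i))"
    unfolding scalar_product_def by (rule order_trans[OF norm_sum]) (simp add: norm_mult)
  also have "\<dots> \<le> norm a * norm z"
    using L2_set_mult_ineq[where A = UNIV and f = "\<lambda>i. cmod (a $ i)" and g = "\<lambda>i. cmod (z $ i)"] by (simp add: norm_vec_def)
  finally show ?thesis .
qed

lemma bounded_linear_scalar_product: "bounded_linear (scalar_product (a :: complex ^ 'n))"
  by (rule bounded_linear_intro[where K = "norm a"])
     (simp_all add: scaleR_conv_of_real[where 'a = complex] mult.commute[of "norm _" "norm a"] norm_scalar_product_le)

section \<open>Regularity of holomorphic functions and restriction to complex lines\<close>

lemma holomorphic_Cn_continuous: "holomorphic_Cn f \<Longrightarrow> continuous_on S f"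
  unfolding holomorphic_Cn_def
  by (meson continuous_at_imp_continuous_on has_derivative_continuous)

lemma holomorphic_Cn_measurable: "holomorphic_Cn f \<Longrightarrow> f \<in> borel_measurable borel"
  by (intro borel_measurable_continuous_onI holomorphic_Cn_continuous)

text \<open>Gives access to the one-variable Cauchy formula: rotations of \<open>w\<close> move
  inside the complex line through \<open>w\<close>.\<close>

lemma holomorphic_Cn_line:
  assumes "holomorphic_Cn f"
  shows "(\<lambda>c. f (c *s w)) holomorphic_on UNIV"
proof -
  have "\<exists>d. ((\<lambda>c. f (c *s w)) has_field_derivative d) (at c)" for c
  proof -
    obtain d where d: "(f has_derivative scalar_product d) (at (c *s w))"
      using assms by (auto simp: holomorphic_Cn_def)
    have "bounded_linear (\<lambda>c. c *s w)"
      by (rule bounded_linear_intro[where K = "norm w"])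
         (auto simp: vector_sadd_rdistrib vec_eq_iff algebra_simps norm_vec_def L2_set_mult_ineq
           norm_mult L2_set_right_distrib mult.commute)
    then have "((\<lambda>c. c *s w) has_derivative (\<lambda>c. c *s w)) (at c)"
      by (rule bounded_linear.has_derivative) simp
    from has_derivative_compose[OF this d] have "((\<lambda>c. f (c *s w)) has_derivative (\<lambda>h. h * scalar_product d w)) (at c)"
      by simp
    then have "((\<lambda>c. f (c *s w)) has_field_derivative scalar_product d w) (at c)"
      unfolding has_field_derivative_def by (rule has_derivative_eq_rhs) (simp add: fun_eq_iff)
    then show ?thesis ..
  qed
  then show ?thesis by (simp add: holomorphic_on_def field_differentiable_def)
qed

text \<open>Absorbs the weight exp(-lam |z|^2 / 2) into the measure, so that Fock norms and inner
  products become plain square-integral expressions.\<close>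

definition gauss :: "real \<Rightarrow> (complex ^ 'n) measure" where
  "gauss lam = density lborel
     (\<lambda>z. ennreal (lam ^ CARD('n) / (2 * pi) ^ CARD('n) * exp (- lam * (norm z)\<^sup>2 / 2)))"

lemma sets_gauss [simp, measurable_cong]: "sets (gauss lam) = sets borel"
  by (simp add: gauss_def)

lemma space_gauss [simp]: "space (gauss lam) = UNIV"
  by (simp add: gauss_def)

context
  fixes lam :: real
  assumes lam: "lam > 0"
begin

lemma gauss_const_pos: "0 < lam ^ n / (2 * pi) ^ n"
  using lam by simp

lemma finite_measure_gauss: "finite_measure (gauss lam :: (complex ^ 'n) measure)"
proof
  have "emeasure (gauss lam :: (complex ^ 'n) measure) UNIV
     = ennreal (lam ^ CARD('n) / (2 * pi) ^ CARD('n)) *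
       (\<integral>\<^sup>+z. ennreal (exp (- (lam / 2) * (norm (z :: complex ^ 'n))\<^sup>2)) \<partial>lborel)"
    using gauss_const_pos[of "CARD('n)"]
    by (simp add: gauss_def emeasure_density nn_integral_cmult[symmetric] ennreal_mult[symmetric])
  also have "\<dots> < \<infinity>"
    using nn_integral_gaussian_finite[of "lam / 2", where 'a = "complex ^ 'n"] lam
    by (simp add: ennreal_mult_less_top)
  finally show "emeasure (gauss lam :: (complex ^ 'n) measure) (space (gauss lam)) \<noteq> \<infinity>" by simp
qed

text \<open>The density depends on the norm alone, so invariance is inherited from
  \<open>lborel\<close>.\<close>

lemma distr_gauss_orthogonal_transformation:
  fixes R :: "complex ^ 'n \<Rightarrow> complex ^ 'n"
  assumes R: "orthogonal_transformation R"
  shows "distr (gauss lam) borel R = gauss lam"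
proof -
  have [measurable]: "R \<in> borel_measurable borel"
    using orthogonal_transformation_linear[OF R] linear_continuous_on linear_conv_bounded_linear
      borel_measurable_continuous_onI by blast
  define g where "g = (\<lambda>z::complex ^ 'n. ennreal (lam ^ CARD('n) / (2 * pi) ^ CARD('n) * exp (- lam * (norm z)\<^sup>2 / 2)))"
  have "g z = g (R z)" for z
    using orthogonal_transformation_norm[OF R] by (simp add: g_def)
  then have "distr (gauss lam) borel R = distr (density lborel (\<lambda>z. g (R z))) borel R"
    by (simp add: gauss_def g_def)
  also have "\<dots> = density (distr lborel borel R) g"
    by (rule density_distr[symmetric]) (auto simp: g_def)
  finally show ?thesis by (simp add: distr_lborel_orthogonal_transformation[OF R] gauss_def g_def)
qed

text \<open>This mass is the factor in the reproducing formula. It is cancelled whenever values of a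
  function are recovered from inner products.\<close>

lemma measure_gauss_pos: "0 < measure (gauss lam :: (complex ^ 'n) measure) UNIV"
proof -
  interpret finite_measure "gauss lam :: (complex ^ 'n) measure" by (rule finite_measure_gauss)
  define w where "w = (\<lambda>z::complex ^ 'n. lam ^ CARD('n) / (2 * pi) ^ CARD('n) * exp (- lam * (norm z)\<^sup>2 / 2))"
  have wpos: "0 < w z" for z
    unfolding w_def by (intro mult_pos_pos gauss_const_pos) simp
  have "emeasure (gauss lam :: (complex ^ 'n) measure) UNIV \<noteq> 0"
  proof
    assume "emeasure (gauss lam :: (complex ^ 'n) measure) UNIV = 0"
    then have "(\<integral>\<^sup>+z. ennreal (w z) \<partial>lborel) = 0"
      by (simp add: gauss_def emeasure_density w_def)
    then have "AE z in lborel. ennreal (w z) = 0"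
      by (subst (asm) nn_integral_0_iff_AE) (auto simp: w_def)
    then have "AE z::complex ^ 'n in lborel. False"
      by eventually_elim (use wpos in \<open>auto simp: ennreal_eq_0_iff not_le[symmetric]\<close>)
    then show False using emeasure_lborel_UNIV[where 'a="complex ^ 'n"]
      by (simp add: AE_iff_measurable[OF _ refl])
  qed
  then show ?thesis by (simp add: emeasure_eq_measure zero_less_measure_iff)
qed

text \<open>Rotations \<open>w \<mapsto> e\<^sup>i\<^sup>t w\<close> preserve the Gaussian measure, and the average of \<open>f(e\<^sup>i\<^sup>t w)\<close> over
  \<open>t\<close> is \<open>f(0)\<close>.\<close>

lemma gauss_mean_value:
  fixes f :: "complex ^ 'n \<Rightarrow> complex"
  assumes f: "holomorphic_Cn f" and int: "integrable (gauss lam) f"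
  shows "(LINT w|gauss lam. f w) = of_real (measure (gauss lam :: (complex ^ 'n) measure) UNIV) * f 0"
proof -
  define e where "e = (\<lambda>t::real. exp (2 * of_real pi * \<i> * of_real t) :: complex)"
  define R where "R = (\<lambda>t (w :: complex ^ 'n). e t *s w)"
  have e1: "cmod (e t) = 1" for t by (simp add: e_def)
  have R: "orthogonal_transformation (R t)" for t
  proof -
    have "norm (R t w) = norm w" for w
      by (simp add: R_def norm_vec_def norm_mult e1)
    moreover have "linear (R t)"
      by (auto simp: R_def vec_eq_iff algebra_simps intro!: linearI)
    ultimately show ?thesis by (simp add: orthogonal_transformation)
  qed
  have cR: "continuous_on UNIV (\<lambda>p. R (fst p) (snd p))"
    unfolding R_def e_def vector_scalar_mult_def by (intro continuous_intros)
  have cont: "continuous_on UNIV (\<lambda>p. f (R (fst p) (snd p)))"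
    by (rule continuous_on_compose2[OF holomorphic_Cn_continuous[OF f, of UNIV] cR]) auto
  have meas [measurable]: "(\<lambda>p. f (R (fst p) (snd p))) \<in> borel_measurable (borel \<Otimes>\<^sub>M borel)"
    using borel_measurable_continuous_onI[OF cont] by (simp add: borel_prod)
  have [measurable]: "R t \<in> borel_measurable borel" for t
    using orthogonal_transformation_linear[OF R] linear_continuous_on linear_conv_bounded_linear
      borel_measurable_continuous_onI by blast
  have [measurable]: "f \<in> borel_measurable borel" by (rule holomorphic_Cn_measurable[OF f])
  have rot: "(LINT w|gauss lam. h (R t w)) = (LINT w|gauss lam. h w)"
    if [measurable]: "h \<in> borel_measurable borel" for t and h :: "complex ^ 'n \<Rightarrow> 'b::{banach, second_countable_topology}"
  proof -
    have "(LINT w|gauss lam. h w) = (LINT w|distr (gauss lam) borel (R t). h w)"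
      by (simp add: distr_gauss_orthogonal_transformation[OF R])
    also have "\<dots> = (LINT w|gauss lam. h (R t w))" by (simp add: integral_distr)
    finally show ?thesis ..
  qed
  have roti: "integrable (gauss lam) (\<lambda>w. f (R t w))" for t
  proof -
    have "integrable (distr (gauss lam) borel (R t)) f"
      using int by (simp add: distr_gauss_orthogonal_transformation[OF R])
    then show ?thesis by (simp add: integrable_distr_eq)
  qed
  \<comment> \<open>The indicator turns the average over [0,1] into an integral over the whole line,
    so that Fubini applies to \<open>lborel\<close> and the Gaussian.\<close>
  define F where "F = (\<lambda>t w. indicator {0..1::real} t *\<^sub>R f (R t w))"
  interpret G: finite_measure "gauss lam :: (complex ^ 'n) measure" by (rule finite_measure_gauss)
  interpret P: pair_sigma_finite "lborel :: real measure" "gauss lam :: (complex ^ 'n) measure" ..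
  have "integrable (lborel \<Otimes>\<^sub>M gauss lam) (case_prod F)"
  proof (rule P.Fubini_integrable)
    show "case_prod F \<in> borel_measurable (lborel \<Otimes>\<^sub>M gauss lam)"
      unfolding F_def case_prod_beta by measurable
    \<comment> \<open>By rotation invariance the inner integral of the norm is constant in t on
      [0,1], which gives joint integrability.\<close>
    have "(\<lambda>t. LINT w|gauss lam. norm (case_prod F (t, w))) = (\<lambda>t. indicator {0..1} t *\<^sub>R (LINT w|gauss lam. norm (f w)))"
      using rot[of "\<lambda>w. norm (f w)"] by (auto simp: F_def fun_eq_iff)
    then show "integrable lborel (\<lambda>t. LINT w|gauss lam. norm (case_prod F (t, w)))"
      by simp
    show "AE t in lborel. integrable (gauss lam) (\<lambda>w. case_prod F (t, w))"
      by (simp add: F_def roti)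
  qed
  then have "(LINT w|gauss lam. LINT t|lborel. F t w) = (LINT t|lborel. LINT w|gauss lam. F t w)"
    by (rule P.Fubini_integral)
  moreover have "(LINT t|lborel. F t w) = f 0" for w
  proof -
    have "((\<lambda>t. f (R t w)) has_integral f 0) {0..1}"
      using circle_average[OF holomorphic_Cn_line[OF f, of w]] by (simp add: R_def e_def)
    moreover have "set_integrable lborel {0..1} (\<lambda>t. f (R t w))"
    proof (rule borel_integrable_compact[unfolded set_integrable_def[symmetric]])
      show "continuous_on {0..1} (\<lambda>t. f (R t w))"
        by (rule continuous_on_compose2[OF cont, of _ "\<lambda>t. (t, w)", simplified]) (intro continuous_intros)
    qed simp
    ultimately show ?thesis
      using set_borel_integral_eq_integral(2)[of "{0..1}" "\<lambda>t. f (R t w)"]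
      by (simp add: F_def set_lebesgue_integral_def integral_unique)
  qed
  moreover have "(LINT w|gauss lam. F t w) = indicator {0..1} t *\<^sub>R (LINT w|gauss lam. f w)" for t
    using rot[of f t] by (simp add: F_def)
  ultimately show ?thesis by (simp add: scaleR_conv_of_real)
qed

end

subsection \<open>The Fock space\<close>

lemma holomorphic_Cn_const [simp]: "holomorphic_Cn (\<lambda>z. c)"
  by (auto simp: holomorphic_Cn_def intro!: exI[of _ 0])

lemma holomorphic_Cn_add:
  assumes "holomorphic_Cn f" "holomorphic_Cn g"
  shows "holomorphic_Cn (\<lambda>z. f z + g z)"
  unfolding holomorphic_Cn_def
proof
  fix z
  obtain d e where "(f has_derivative scalar_product d) (at z)" "(g has_derivative scalar_product e) (at z)"
    using assms by (meson holomorphic_Cn_def)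
  from has_derivative_add[OF this]
  have "((\<lambda>z. f z + g z) has_derivative scalar_product (d + e)) (at z)"
    by (rule has_derivative_eq_rhs) (simp add: fun_eq_iff)
  then show "\<exists>d. ((\<lambda>z. f z + g z) has_derivative scalar_product d) (at z)" ..
qed

lemma holomorphic_Cn_mult:
  assumes "holomorphic_Cn f" "holomorphic_Cn g"
  shows "holomorphic_Cn (\<lambda>z. f z * g z)"
  unfolding holomorphic_Cn_def
proof
  fix z
  obtain d e where "(f has_derivative scalar_product d) (at z)" "(g has_derivative scalar_product e) (at z)"
    using assms by (meson holomorphic_Cn_def)
  from has_derivative_mult[OF this]
  have "((\<lambda>z. f z * g z) has_derivative scalar_product (f z *s e + g z *s d)) (at z)"
    by (rule has_derivative_eq_rhs) (simp add: fun_eq_iff mult.commute)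
  then show "\<exists>d. ((\<lambda>z. f z * g z) has_derivative scalar_product d) (at z)" ..
qed

lemma holomorphic_Cn_scalar_product [simp]: "holomorphic_Cn (scalar_product a)"
  using bounded_linear.has_derivative[OF bounded_linear_scalar_product has_derivative_ident]
  by (auto simp: holomorphic_Cn_def)

lemma holomorphic_Cn_exp:
  assumes "holomorphic_Cn f"
  shows "holomorphic_Cn (\<lambda>z. exp (f z))"
  unfolding holomorphic_Cn_def
proof
  fix z
  obtain d where "(f has_derivative scalar_product d) (at z)"
    using assms by (auto simp: holomorphic_Cn_def)
  from has_derivative_compose[OF this DERIV_exp[THEN has_field_derivative_imp_has_derivative]]
  have "((\<lambda>z. exp (f z)) has_derivative scalar_product (exp (f z) *s d)) (at z)"
    by (rule has_derivative_eq_rhs) (simp add: fun_eq_iff mult.commute)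
  then show "\<exists>d. ((\<lambda>z. exp (f z)) has_derivative scalar_product d) (at z)" ..
qed

lemma holomorphic_Cn_translate:
  assumes "holomorphic_Cn f"
  shows "holomorphic_Cn (\<lambda>z. f (z - u))"
  unfolding holomorphic_Cn_def
proof
  fix z
  obtain d where d: "(f has_derivative scalar_product d) (at (z - u))"
    using assms by (auto simp: holomorphic_Cn_def)
  have "((\<lambda>z. z - u) has_derivative (\<lambda>h. h)) (at z)"
    by (auto intro!: derivative_eq_intros)
  from has_derivative_compose[OF this d]
  show "\<exists>d. ((\<lambda>z. f (z - u)) has_derivative scalar_product d) (at z)" by auto
qed

lemma fock_holomorphic: "f \<in> fock lam \<Longrightarrow> holomorphic_Cn f"
  by (simp add: fock_def)

lemma fock_measurable: "f \<in> fock lam \<Longrightarrow> f \<in> borel_measurable borel"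
  by (simp add: fock_holomorphic holomorphic_Cn_measurable)

lemma norm_sub_square: "(norm (z - u))\<^sup>2 = (norm z)\<^sup>2 + (norm u)\<^sup>2 - 2 * Re (scalar_product (vcnj u) z)"
  for z u :: "complex ^ 'n"
  by (simp add: Re_scalar_product_vcnj power2_norm_eq_inner inner_diff_left inner_diff_right inner_commute)

lemma borel_measurable_cnj [measurable]: "cnj \<in> borel_measurable borel"
  by (intro borel_measurable_continuous_onI continuous_intros)

lemma fock_inner_cnj: "fock_inner lam g f = cnj (fock_inner lam f g)"
  unfolding fock_inner_def Bochner_Integration.integral_cnj[symmetric]
  by (rule Bochner_Integration.integral_cong) (simp_all add: mult_ac)

context
  fixes lam :: real
  assumes lam: "lam > 0"
begin

lemma gauss_density_mu:
  "gauss lam = density (mu lam :: (complex ^ 'n) measure) (\<lambda>z. ennreal (exp (- lam * (norm z)\<^sup>2 / 2)))"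
  using gauss_const_pos[OF lam, of "CARD('n)"]
  by (simp add: gauss_def mu_def density_density_eq ennreal_mult[symmetric])

lemma fock_iff:
  "f \<in> fock lam \<longleftrightarrow> holomorphic_Cn f \<and> integrable (gauss lam) (\<lambda>z. (cmod (f z))\<^sup>2)"
proof (cases "holomorphic_Cn f")
  case True
  note [measurable] = holomorphic_Cn_measurable[OF True]
  show ?thesis unfolding gauss_density_mu
    by (subst integrable_density) (simp_all add: fock_def mu_def True mult.commute)
qed (simp add: fock_def)

lemma fock_norm_eq:
  assumes "f \<in> fock lam"
  shows "fock_norm lam f = sqrt (LINT z|gauss lam. (cmod (f z))\<^sup>2)"
proof -
  note [measurable] = fock_measurable[OF assms]
  show ?thesis unfolding gauss_density_mu fock_norm_def
    by (subst integral_density) (simp_all add: mu_def mult.commute)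
qed

lemma fock_inner_eq:
  assumes "f \<in> fock lam" "g \<in> fock lam"
  shows "fock_inner lam f g = (LINT z|gauss lam. f z * cnj (g z))"
proof -
  note [measurable] = fock_measurable[OF assms(1)] fock_measurable[OF assms(2)]
  show ?thesis unfolding gauss_density_mu fock_inner_def
    by (subst integral_density) (simp_all add: mu_def scaleR_conv_of_real mult.commute)
qed

lemma integrable_fock_square: "f \<in> fock lam \<Longrightarrow> integrable (gauss lam) (\<lambda>z. (cmod (f z))\<^sup>2)"
  by (simp add: fock_iff)

lemma integrable_fock_prod:
  assumes f: "f \<in> fock lam" and g: "g \<in> fock lam"
  shows "integrable (gauss lam) (\<lambda>z. f z * cnj (g z))"
proof (rule Bochner_Integration.integrable_bound)
  note [measurable] = fock_measurable[OF f] fock_measurable[OF g]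
  show "integrable (gauss lam) (\<lambda>z. (cmod (f z))\<^sup>2 + (cmod (g z))\<^sup>2)"
    using f g by (simp add: fock_iff)
  show "(\<lambda>z. f z * cnj (g z)) \<in> borel_measurable (gauss lam)" by measurable
  have "cmod (f z) * cmod (g z) \<le> (cmod (f z))\<^sup>2 + (cmod (g z))\<^sup>2" for z
    using sum_squares_bound[of "cmod (f z)" "cmod (g z)"] zero_le_power2[of "cmod (f z)"] zero_le_power2[of "cmod (g z)"]
      mult_nonneg_nonneg[of "cmod (f z)" "cmod (g z)"] by linarith
  then show "AE z in gauss lam. norm (f z * cnj (g z)) \<le> norm ((cmod (f z))\<^sup>2 + (cmod (g z))\<^sup>2)"
    by (auto simp: norm_mult)
qed

lemma fock_scale: "f \<in> fock lam \<Longrightarrow> (\<lambda>z. a * f z) \<in> fock lam"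
  by (auto simp: fock_iff norm_mult power_mult_distrib intro!: holomorphic_Cn_mult)

lemma fock_add:
  assumes f: "f \<in> fock lam" and g: "g \<in> fock lam"
  shows "(\<lambda>z. f z + g z) \<in> fock lam"
  unfolding fock_iff
proof
  note [measurable] = fock_measurable[OF f] fock_measurable[OF g]
  show "holomorphic_Cn (\<lambda>z. f z + g z)"
    using f g by (intro holomorphic_Cn_add) (auto simp: fock_holomorphic)
  show "integrable (gauss lam) (\<lambda>z. (cmod (f z + g z))\<^sup>2)"
  proof (rule Bochner_Integration.integrable_bound)
    show "integrable (gauss lam) (\<lambda>z. 2 * (cmod (f z))\<^sup>2 + 2 * (cmod (g z))\<^sup>2)"
      using f g by (simp add: fock_iff)
    have "(cmod (f z + g z))\<^sup>2 \<le> 2 * (cmod (f z))\<^sup>2 + 2 * (cmod (g z))\<^sup>2" for z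
    proof -
      have "(cmod (f z + g z))\<^sup>2 \<le> (cmod (f z) + cmod (g z))\<^sup>2"
        by (intro power_mono norm_triangle_ineq) simp
      also have "\<dots> \<le> 2 * (cmod (f z))\<^sup>2 + 2 * (cmod (g z))\<^sup>2"
        using sum_squares_bound[of "cmod (f z)" "cmod (g z)"] by (simp add: power2_sum)
      finally show ?thesis .
    qed
    then show "AE z in gauss lam. norm ((cmod (f z + g z))\<^sup>2) \<le> norm (2 * (cmod (f z))\<^sup>2 + 2 * (cmod (g z))\<^sup>2)"
      by auto
  qed measurable
qed

lemma fock_zero [simp]: "(\<lambda>z. 0) \<in> fock lam"
  by (simp add: fock_iff)

lemma fock_diff: "f \<in> fock lam \<Longrightarrow> g \<in> fock lam \<Longrightarrow> (\<lambda>z. f z - g z) \<in> fock lam"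
  using fock_add[of f "\<lambda>z. (-1) * g z"] fock_scale[of g "-1"] by simp

lemma fock_inner_add_left:
  assumes "f \<in> fock lam" "g \<in> fock lam" "h \<in> fock lam"
  shows "fock_inner lam (\<lambda>z. f z + g z) h = fock_inner lam f h + fock_inner lam g h"
  using assms by (simp add: fock_inner_eq fock_add integrable_fock_prod distrib_right)

lemma fock_inner_scale_left:
  assumes "f \<in> fock lam" "h \<in> fock lam"
  shows "fock_inner lam (\<lambda>z. a * f z) h = a * fock_inner lam f h"
  using assms by (simp add: fock_inner_eq fock_scale mult.assoc)

lemma fock_inner_diff_left:
  assumes "f \<in> fock lam" "g \<in> fock lam" "h \<in> fock lam"
  shows "fock_inner lam (\<lambda>z. f z - g z) h = fock_inner lam f h - fock_inner lam g h"
  using assms by (simp add: fock_inner_eq fock_diff integrable_fock_prod left_diff_distrib)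

lemma fock_inner_scale_right:
  assumes "f \<in> fock lam" "h \<in> fock lam"
  shows "fock_inner lam h (\<lambda>z. a * f z) = cnj a * fock_inner lam h f"
  using fock_inner_scale_left[OF assms, of a] fock_inner_cnj[of lam h] by simp

lemma fock_inner_diff_right:
  assumes "f \<in> fock lam" "g \<in> fock lam" "h \<in> fock lam"
  shows "fock_inner lam h (\<lambda>z. f z - g z) = fock_inner lam h f - fock_inner lam h g"
  using fock_inner_diff_left[OF assms] fock_inner_cnj[of lam h] by simp

lemma fock_norm_nonneg [simp]: "0 \<le> fock_norm lam f"
  by (simp add: fock_norm_def)

lemma fock_norm_square:
  "f \<in> fock lam \<Longrightarrow> (fock_norm lam f)\<^sup>2 = (LINT z|gauss lam. (cmod (f z))\<^sup>2)"
  by (simp add: fock_norm_eq)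

lemma fock_inner_self: "f \<in> fock lam \<Longrightarrow> fock_inner lam f f = of_real ((fock_norm lam f)\<^sup>2)"
  by (simp add: fock_norm_square fock_inner_eq complex_norm_square[symmetric] of_real_power[symmetric]
      del: of_real_power)

text \<open>Integrating 2xy \<le> s x^2 + y^2 / s bounds the integral of |f g| for every s > 0; the
  best s is the quotient of the two norms.\<close>

lemma fock_Cauchy_Schwarz:
  assumes f: "f \<in> fock lam" and g: "g \<in> fock lam"
  shows "cmod (fock_inner lam f g) \<le> fock_norm lam f * fock_norm lam g"
proof -
  define P where "P = (LINT z|gauss lam. cmod (f z) * cmod (g z))"
  define a where "a = fock_norm lam f"
  define b where "b = fock_norm lam g"
  have a2: "a\<^sup>2 = (LINT z|gauss lam. (cmod (f z))\<^sup>2)" and b2: "b\<^sup>2 = (LINT z|gauss lam. (cmod (g z))\<^sup>2)"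
    using f g by (simp_all add: a_def b_def fock_norm_square)
  have ab: "a \<ge> 0" "b \<ge> 0" by (simp_all add: a_def b_def)
  have intP: "integrable (gauss lam) (\<lambda>z. cmod (f z) * cmod (g z))"
    using integrable_norm[OF integrable_fock_prod[OF f g]] by (simp add: norm_mult)
  note int = integrable_fock_square[OF f] integrable_fock_square[OF g] intP
  have bound: "2 * P \<le> s * a\<^sup>2 + b\<^sup>2 / s" if s: "s > 0" for s
  proof -
    have "2 * P = (LINT z|gauss lam. 2 * (cmod (f z) * cmod (g z)))"
      by (simp add: P_def)
    also have "\<dots> \<le> (LINT z|gauss lam. s * (cmod (f z))\<^sup>2 + (cmod (g z))\<^sup>2 / s)"
    proof (rule integral_mono)
      fix z
      have "0 \<le> (s * cmod (f z) - cmod (g z))\<^sup>2 / s" using s by simp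
      also have "\<dots> = s * (cmod (f z))\<^sup>2 + (cmod (g z))\<^sup>2 / s - 2 * (cmod (f z) * cmod (g z))"
        using s by (simp add: power2_eq_square field_simps)
      finally show "2 * (cmod (f z) * cmod (g z)) \<le> s * (cmod (f z))\<^sup>2 + (cmod (g z))\<^sup>2 / s" by simp
    qed (use int in auto)
    also have "\<dots> = s * a\<^sup>2 + b\<^sup>2 / s" using int by (simp add: a2 b2)
    finally show ?thesis .
  qed
  have "P \<le> a * b"
  proof (rule field_le_epsilon)
    fix e :: real assume e: "e > 0"
    \<comment> \<open>The optimal s = b/a may be zero or undefined. Shifting a and b by d keeps it
      positive and costs at most d (a + b), which this d keeps below 2e.\<close>
    define d where "d = e / (a + b + 1)"
    have d: "d > 0" using e ab by (simp add: d_def)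
    have "a / (a + d) \<le> 1" "b / (b + d) \<le> 1" using ab d by (auto simp: field_simps)
    have "2 * P \<le> (b + d) / (a + d) * a\<^sup>2 + b\<^sup>2 / ((b + d) / (a + d))"
      using d ab by (intro bound) simp
    also have "\<dots> = (b + d) * a * (a / (a + d)) + (a + d) * b * (b / (b + d))"
      by (simp add: power2_eq_square mult_ac)
    also have "\<dots> \<le> (b + d) * a + (a + d) * b"
      using \<open>a / (a + d) \<le> 1\<close> \<open>b / (b + d) \<le> 1\<close> ab d
      by (intro add_mono mult_right_le_one_le) auto
    also have "\<dots> = 2 * a * b + d * (a + b)" by (simp add: algebra_simps)
    also have "d * (a + b) \<le> 2 * e" using e ab by (simp add: d_def field_simps)
    finally show "P \<le> a * b + e" by simp
  qed
  moreover have "cmod (fock_inner lam f g) \<le> P"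
    using f g integral_norm_bound[of "gauss lam" "\<lambda>z. f z * cnj (g z)"] by (simp add: P_def fock_inner_eq norm_mult)
  ultimately show ?thesis by (simp add: a_def b_def)
qed

text \<open>Half of the Gaussian exponent absorbs the exponential: completing the square gives c r
  \<le> lam r^2 / 4 + c^2 / lam.\<close>

lemma integrable_gauss_exp:
  "integrable (gauss lam) (\<lambda>z::complex ^ 'n. K * exp (c * norm z))"
proof -
  define k where "k = lam ^ CARD('n) / (2 * pi) ^ CARD('n)"
  have k: "k > 0" unfolding k_def by (rule gauss_const_pos[OF lam])
  have "integrable lborel (\<lambda>z::complex ^ 'n. k * exp (- lam * (norm z)\<^sup>2 / 2) * exp (c * norm z))"
  proof (rule Bochner_Integration.integrable_bound)
    show "integrable lborel (\<lambda>z::complex ^ 'n. (k * exp (c\<^sup>2 / lam)) * exp (- (lam / 4) * (norm z)\<^sup>2))"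
      using lam by (intro integrable_mult_right integrable_gaussian) simp
    have "- lam * r\<^sup>2 / 2 + c * r \<le> c\<^sup>2 / lam + - (lam / 4) * r\<^sup>2" for r
    proof -
      have "0 \<le> (lam * r - 2 * c)\<^sup>2 / (4 * lam)" using lam by simp
      also have "\<dots> = lam / 4 * r\<^sup>2 - c * r + c\<^sup>2 / lam"
        using lam by (simp add: power2_eq_square field_simps)
      finally show ?thesis by simp
    qed
    then show "AE z::complex ^ 'n in lborel. norm (k * exp (- lam * (norm z)\<^sup>2 / 2) * exp (c * norm z))
        \<le> norm ((k * exp (c\<^sup>2 / lam)) * exp (- (lam / 4) * (norm z)\<^sup>2))"
      using k by (auto simp: abs_mult mult.assoc exp_add[symmetric] simp del: mult_minus_left minus_mult_left[symmetric])
  qed simp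
  then have "integrable (gauss lam) (\<lambda>z::complex ^ 'n. exp (c * norm z))"
    unfolding gauss_def k_def[symmetric]
    by (subst integrable_density) (use k in auto)
  then show ?thesis by (rule integrable_mult_right)
qed

lemma fock_of_bound:
  fixes f :: "complex ^ 'n \<Rightarrow> complex"
  assumes f: "holomorphic_Cn f" and b: "\<And>z. cmod (f z) \<le> K * exp (K * norm z)"
  shows "f \<in> fock lam"
  unfolding fock_iff
proof (intro conjI f)
  note [measurable] = holomorphic_Cn_measurable[OF f]
  show "integrable (gauss lam) (\<lambda>z. (cmod (f z))\<^sup>2)"
  proof (rule Bochner_Integration.integrable_bound[OF integrable_gauss_exp])
    have "(cmod (f z))\<^sup>2 \<le> K\<^sup>2 * exp (2 * K * norm z)" for z
      using power_mono[OF b[of z] norm_ge_zero, of 2] by (simp add: power_mult_distrib exp_double[symmetric] mult_ac)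
    then show "AE z in gauss lam. norm ((cmod (f z))\<^sup>2) \<le> norm (K\<^sup>2 * exp (2 * K * norm z))"
      by auto
  qed measurable
qed

text \<open>M depends on the envelope K only. The factor c is what later tends to 0: it will be |y -
  x| for continuity and |y - x|^2 for differentiability.\<close>

lemma fock_norm_bound:
  "\<exists>M\<ge>0. \<forall>f::complex ^ 'n \<Rightarrow> complex. \<forall>c\<ge>0. f \<in> fock lam \<longrightarrow> (\<forall>z. cmod (f z) \<le> c * (K * exp (K * norm z))) \<longrightarrow> fock_norm lam f \<le> c * M"
proof (intro exI conjI allI impI)
  define M where "M = sqrt (LINT z::complex ^ 'n|gauss lam. K\<^sup>2 * exp (2 * K * norm z))"
  show "M \<ge> 0" by (simp add: M_def)
  fix f :: "complex ^ 'n \<Rightarrow> complex" and c :: real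
  assume c: "c \<ge> 0" and f: "f \<in> fock lam" and b: "\<forall>z. cmod (f z) \<le> c * (K * exp (K * norm z))"
  have "(LINT z|gauss lam. (cmod (f z))\<^sup>2) \<le> (LINT z::complex ^ 'n|gauss lam. c\<^sup>2 * (K\<^sup>2 * exp (2 * K * norm z)))"
  proof (rule integral_mono)
    show "integrable (gauss lam) (\<lambda>z::complex ^ 'n. c\<^sup>2 * (K\<^sup>2 * exp (2 * K * norm z)))"
      by (intro integrable_mult_right[of "c\<^sup>2"] integrable_gauss_exp)
    show "(cmod (f z))\<^sup>2 \<le> c\<^sup>2 * (K\<^sup>2 * exp (2 * K * norm z))" for z
      using power_mono[OF b[rule_format, of z] norm_ge_zero, of 2]
      by (simp add: power_mult_distrib exp_double[symmetric] mult_ac)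
  qed (rule integrable_fock_square[OF f])
  then have "fock_norm lam f \<le> sqrt (c\<^sup>2 * (LINT z::complex ^ 'n|gauss lam. K\<^sup>2 * exp (2 * K * norm z)))"
    by (simp add: fock_norm_eq[OF f])
  also have "\<dots> = c * M" using c by (simp add: M_def real_sqrt_mult)
  finally show "fock_norm lam f \<le> c * M" .
qed

end

subsection \<open>Weyl operators and the reproducing property\<close>

text \<open>The representation at the group element with central coordinate 0; by
  \<open>rho_heis\<close> a central coordinate only adds a scalar of modulus 1.\<close>

definition weyl :: "real \<Rightarrow> complex ^ 'n \<Rightarrow> (complex ^ 'n \<Rightarrow> complex) \<Rightarrow> complex ^ 'n \<Rightarrow> complex" where
  "weyl lam u f = (\<lambda>z. exp (complex_of_real lam / 2 * scalar_product (vcnj u) z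
     - complex_of_real (lam / 4 * (norm u)\<^sup>2)) * f (z - u))"

lemma rho_heis:
  "rho lam (heis (u, c)) f z = exp (\<i> * complex_of_real lam * complex_of_real c) * weyl lam u f z"
  by (simp add: rho_def heis_def weyl_def exp_add[symmetric] algebra_simps)

lemma weyl_zero [simp]: "weyl lam 0 f = f"
  by (simp add: weyl_def)

lemma weyl_scale: "weyl lam u (\<lambda>z. c * f z) = (\<lambda>z. c * weyl lam u f z)"
  by (simp add: weyl_def fun_eq_iff)

text \<open>The symplectic form vanishes on a real line, so the product of two such operators
  carries no phase and they form a one-parameter group.\<close>

lemma weyl_scaleR_add: "weyl lam ((s + t) *\<^sub>R u) f = weyl lam (s *\<^sub>R u) (weyl lam (t *\<^sub>R u) f)"
proof -
  have norm_sq: "(norm (r *\<^sub>R u))\<^sup>2 = r\<^sup>2 * (norm u)\<^sup>2" for r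
    by (simp add: power_mult_distrib)
  have "exp (complex_of_real lam / 2 * scalar_product (vcnj ((s + t) *\<^sub>R u)) z - complex_of_real (lam / 4 * (norm ((s + t) *\<^sub>R u))\<^sup>2))
     = exp (complex_of_real lam / 2 * scalar_product (vcnj (s *\<^sub>R u)) z - complex_of_real (lam / 4 * (norm (s *\<^sub>R u))\<^sup>2))
     * exp (complex_of_real lam / 2 * scalar_product (vcnj (t *\<^sub>R u)) (z - s *\<^sub>R u) - complex_of_real (lam / 4 * (norm (t *\<^sub>R u))\<^sup>2))"
    for z
    unfolding exp_add[symmetric] norm_sq scalar_product_diff_right vcnj_simps scalar_product_scaleR scalar_product_vcnj_self
    by (rule arg_cong[of _ _ exp]) (simp add: field_simps power2_eq_square)
  note eq = this
  show ?thesis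
  proof
    fix z
    have "z - (s + t) *\<^sub>R u = z - s *\<^sub>R u - t *\<^sub>R u"
      by (simp add: scaleR_left_distrib)
    then show "weyl lam ((s + t) *\<^sub>R u) f z = weyl lam (s *\<^sub>R u) (weyl lam (t *\<^sub>R u) f) z"
      unfolding weyl_def eq[of z] by (simp only: mult.assoc)
  qed
qed

text \<open>Multiplier and translated exponent are both affine in z; their linear parts add up to
  the exponent of the coherent state at w + u.\<close>

lemma weyl_coherent:
  "weyl lam u (coherent lam w) = (\<lambda>z. exp (- complex_of_real (lam / 4 * (norm u)\<^sup>2)
     - complex_of_real lam / 2 * scalar_product (vcnj w) u) * coherent lam (w + u) z)"
  unfolding weyl_def coherent_def exp_add[symmetric]
  by (rule ext, rule arg_cong[of _ _ exp]) (simp add: field_simps)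

context
  fixes lam :: real
  assumes lam: "lam > 0"
begin

lemma distr_mu_translate:
  "distr (mu lam) borel (\<lambda>z. z - u) = (mu lam :: (complex ^ 'n) measure)"
proof -
  have "distr (mu lam) borel (\<lambda>z. z - u) = density (distr lborel borel (\<lambda>z. z - u))
      (\<lambda>_. ennreal (lam ^ CARD('n) / (2 * pi) ^ CARD('n)))"
    unfolding mu_def by (rule density_distr[symmetric]) auto
  also have "distr lborel borel (\<lambda>z. z - u) = (lborel :: (complex ^ 'n) measure)"
  proof -
    have "(\<lambda>z. z - u) = (+) (- u)" by auto
    then show ?thesis by (simp only: lborel_distr_plus)
  qed
  finally show ?thesis by (simp add: mu_def)
qed

lemma sets_mu [simp, measurable_cong]: "sets (mu lam :: (complex ^ 'n) measure) = sets borel"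
  by (simp add: mu_def)

text \<open>The squared modulus of the Weyl multiplier is the quotient of the Gaussian weights at z
  - u and z. With translation invariance of \<open>mu\<close> this makes the Weyl operators
  isometric.\<close>

lemma weyl_weight:
  "exp (complex_of_real lam / 2 * scalar_product (vcnj u) z - complex_of_real (lam / 4 * (norm u)\<^sup>2)) *
   cnj (exp (complex_of_real lam / 2 * scalar_product (vcnj u) z - complex_of_real (lam / 4 * (norm u)\<^sup>2))) *
   complex_of_real (exp (- lam * (norm z)\<^sup>2 / 2))
   = complex_of_real (exp (- lam * (norm (z - u))\<^sup>2 / 2))"
proof -
  have "(cmod (exp (complex_of_real lam / 2 * scalar_product (vcnj u) z - complex_of_real (lam / 4 * (norm u)\<^sup>2))))\<^sup>2
      * exp (- lam * (norm z)\<^sup>2 / 2) = exp (- lam * (norm (z - u))\<^sup>2 / 2)"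
    by (simp add: norm_sub_square exp_add[symmetric] exp_double[symmetric] field_simps)
  then show ?thesis
    by (simp only: complex_norm_square[symmetric] of_real_mult[symmetric] of_real_power[symmetric])
qed

lemma weyl_inner:
  assumes f: "f \<in> fock lam" and g: "g \<in> fock lam"
  shows "fock_inner lam (weyl lam u f) (weyl lam u g) = fock_inner lam f g"
proof -
  note [measurable] = fock_measurable[OF f] fock_measurable[OF g]
  have "fock_inner lam f g = (LINT z|distr (mu lam) borel (\<lambda>z. z - u).
      f z * cnj (g z) * complex_of_real (exp (- lam * (norm z)\<^sup>2 / 2)))"
    by (simp add: fock_inner_def distr_mu_translate)
  also have "\<dots> = (LINT z|mu lam. f (z - u) * cnj (g (z - u)) * complex_of_real (exp (- lam * (norm (z - u))\<^sup>2 / 2)))"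
    by (subst integral_distr) auto
  also have "\<dots> = fock_inner lam (weyl lam u f) (weyl lam u g)"
    unfolding fock_inner_def weyl_weight[symmetric]
    by (rule Bochner_Integration.integral_cong) (simp_all add: weyl_def mult_ac)
  finally show ?thesis ..
qed

lemma weyl_in_fock:
  assumes f: "f \<in> fock lam"
  shows "weyl lam u f \<in> fock lam"
proof -
  note [measurable] = fock_measurable[OF f]
  have hol: "holomorphic_Cn (weyl lam u f)"
    using holomorphic_Cn_mult[OF holomorphic_Cn_exp[OF holomorphic_Cn_add[OF
        holomorphic_Cn_scalar_product[of "(complex_of_real lam / 2) *s vcnj u"]
        holomorphic_Cn_const[of "- complex_of_real (lam / 4 * (norm u)\<^sup>2)"]]]
        holomorphic_Cn_translate[OF fock_holomorphic[OF f], of u]]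
    by (simp add: weyl_def)
  have *: "(cmod (weyl lam u f z))\<^sup>2 * exp (- lam * (norm z)\<^sup>2 / 2)
      = (cmod (f (z - u)))\<^sup>2 * exp (- lam * (norm (z - u))\<^sup>2 / 2)" for z
  proof -
    have "complex_of_real ((cmod (weyl lam u f z))\<^sup>2 * exp (- lam * (norm z)\<^sup>2 / 2))
      = complex_of_real ((cmod (f (z - u)))\<^sup>2 * exp (- lam * (norm (z - u))\<^sup>2 / 2))"
      unfolding of_real_mult weyl_weight[symmetric] complex_norm_square
      by (simp only: weyl_def complex_cnj_mult of_real_mult mult_ac)
    then show ?thesis by (simp only: of_real_eq_iff)
  qed
  have "integrable (distr (mu lam) borel (\<lambda>z. z - u)) (\<lambda>z. (cmod (f z))\<^sup>2 * exp (- lam * (norm z)\<^sup>2 / 2))"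
    using f by (simp add: distr_mu_translate fock_def)
  then have "integrable (mu lam) (\<lambda>z. (cmod (f (z - u)))\<^sup>2 * exp (- lam * (norm (z - u))\<^sup>2 / 2))"
    by (subst (asm) integrable_distr_eq) auto
  then show ?thesis using hol unfolding fock_def *[symmetric] by simp
qed

lemma coherent_in_fock: "coherent lam z \<in> fock lam"
\<comment> \<open>The summand 1 makes K at least 1, so that it also serves as the factor in front of
  the exponential.\<close>
proof (rule fock_of_bound[OF lam, where K = "1 + lam / 2 * norm (vcnj z)"])
  show "holomorphic_Cn (coherent lam z)"
    using holomorphic_Cn_exp[OF holomorphic_Cn_scalar_product[of "(complex_of_real lam / 2) *s vcnj z"]]
    by (simp add: coherent_def[abs_def] mult.commute mult.assoc)
  fix w
  have "cmod (coherent lam z w) \<le> exp (cmod (complex_of_real lam * scalar_product (vcnj z) w / 2))"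
    unfolding coherent_def by (rule norm_exp)
  also have "\<dots> \<le> exp ((1 + lam / 2 * norm (vcnj z)) * norm w)"
  proof -
    have "lam * cmod (scalar_product (vcnj z) w) \<le> lam * (norm (vcnj z) * norm w)"
      using lam by (intro mult_left_mono norm_scalar_product_le) simp
    then have "lam * cmod (scalar_product (vcnj z) w) / 2 \<le> lam / 2 * norm (vcnj z) * norm w"
      by simp
    also have "\<dots> \<le> (1 + lam / 2 * norm (vcnj z)) * norm w"
      by (simp add: distrib_right)
    finally show ?thesis using lam by (simp add: norm_mult norm_divide)
  qed
  also have "\<dots> \<le> (1 + lam / 2 * norm (vcnj z)) * exp ((1 + lam / 2 * norm (vcnj z)) * norm w)"
    using lam by simp
  finally show "cmod (coherent lam z w) \<le> (1 + lam / 2 * norm (vcnj z)) * exp ((1 + lam / 2 * norm (vcnj z)) * norm w)" .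
qed

text \<open>\<open>weyl z 1\<close> is a multiple of \<open>e\<^sub>z\<close>, so unitarity reduces the claim to the mean value
  property at the origin. The total mass of the Gaussian is \<open>1\<close>, but only its positivity matters.\<close>

lemma fock_reproducing:
  fixes f :: "complex ^ 'n \<Rightarrow> complex"
  assumes f: "f \<in> fock lam"
  shows "fock_inner lam f (coherent lam z)
    = of_real (measure (gauss lam :: (complex ^ 'n) measure) UNIV) * f z"
proof -
  \<comment> \<open>The reciprocal of the scalar that \<open>weyl_coherent\<close> produces from
    \<open>coherent lam 0\<close>, the constant function 1.\<close>
  define c where "c = complex_of_real (exp (lam / 4 * (norm z)\<^sup>2))"
  have c0: "coherent lam 0 = (\<lambda>z::complex ^ 'n. 1)" by (simp add: coherent_def fun_eq_iff)
  have ez: "coherent lam z = (\<lambda>x. c * weyl lam z (coherent lam 0) x)"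
    by (simp add: weyl_coherent c_def exp_of_real[symmetric] mult.assoc[symmetric] exp_add[symmetric] fun_eq_iff)
  have "fock_inner lam f (coherent lam z) = cnj c * fock_inner lam f (weyl lam z (coherent lam 0))"
    by (subst ez) (rule fock_inner_scale_right[OF lam weyl_in_fock[OF coherent_in_fock] f])
  also have "fock_inner lam f (weyl lam z (coherent lam 0))
      = fock_inner lam (weyl lam (- z) f) (weyl lam (- z) (weyl lam z (coherent lam 0)))"
    by (intro weyl_inner[symmetric] weyl_in_fock f coherent_in_fock)
  also have "weyl lam (- z) (weyl lam z (coherent lam 0)) = coherent lam 0"
    using weyl_scaleR_add[of lam "-1" 1 z "coherent lam 0"] by simp
  also have "fock_inner lam (weyl lam (- z) f) (coherent lam 0) = (LINT w|gauss lam. weyl lam (- z) f w)"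
    by (subst fock_inner_eq[OF lam weyl_in_fock[OF f] coherent_in_fock]) (simp add: c0)
  also have "\<dots> = of_real (measure (gauss lam :: (complex ^ 'n) measure) UNIV) * weyl lam (- z) f 0"
  proof (rule gauss_mean_value[OF lam])
    show "holomorphic_Cn (weyl lam (- z) f)" by (rule fock_holomorphic[OF weyl_in_fock[OF f]])
    show "integrable (gauss lam) (weyl lam (- z) f)"
      using integrable_fock_prod[OF lam weyl_in_fock[OF f] coherent_in_fock[of 0]] by (simp add: c0)
  qed
  also have "cnj c * (of_real (measure (gauss lam :: (complex ^ 'n) measure) UNIV) * weyl lam (- z) f 0)
      = of_real (measure (gauss lam :: (complex ^ 'n) measure) UNIV) * f z"
  proof -
    have "cnj c * exp (- complex_of_real (lam / 4 * (norm z)\<^sup>2)) = 1"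
      unfolding c_def complex_cnj_complex_of_real exp_of_real of_real_minus[symmetric] of_real_mult[symmetric] exp_add[symmetric]
      by simp
    then show ?thesis by (simp add: weyl_def mult.left_commute mult.assoc[symmetric])
  qed
  finally show ?thesis .
qed

text \<open>By the reproducing formula, inner products with coherent states are function values up
  to a non-zero constant.\<close>

lemma fock_eqI:
  assumes f: "f \<in> fock lam" and g: "g \<in> fock lam"
    and eq: "\<And>z. fock_inner lam f (coherent lam z) = fock_inner lam g (coherent lam z)"
  shows "f = g"
proof
  fix z show "f z = g z"
    using eq[of z] measure_gauss_pos[OF lam, where 'n = 'a] by (simp add: fock_reproducing[OF f] fock_reproducing[OF g])
qed

end

subsection \<open>Smooth families of functions in the Fock space\<close>

text \<open>Polynomials in real-linear functionals of the parameter x, conjugates included, and in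
  complex-linear functionals of z. They are thus holomorphic in z and closed under differentiation
  in x.\<close>

inductive poly_family :: "('a::euclidean_space \<Rightarrow> complex ^ 'n \<Rightarrow> complex) \<Rightarrow> bool" where
  const: "poly_family (\<lambda>x z. c)"
| linear: "bounded_linear L \<Longrightarrow> poly_family (\<lambda>x z. L x)"
| coord: "poly_family (\<lambda>x z. scalar_product a z)"
| add: "poly_family p \<Longrightarrow> poly_family q \<Longrightarrow> poly_family (\<lambda>x z. p x z + q x z)"
| mult: "poly_family p \<Longrightarrow> poly_family q \<Longrightarrow> poly_family (\<lambda>x z. p x z * q x z)"

lemma poly_family_sum:
  assumes "\<And>i. i \<in> I \<Longrightarrow> poly_family (p i)"
  shows "poly_family (\<lambda>x z. \<Sum>i\<in>I. p i x z)"
  using assms by (induction I rule: infinite_finite_induct) (auto intro: poly_family.intros)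

lemma poly_family_holomorphic: "poly_family p \<Longrightarrow> holomorphic_Cn (p x)"
  by (induction rule: poly_family.induct) (auto intro: holomorphic_Cn_add holomorphic_Cn_mult)

lemma poly_family_deriv:
  assumes "poly_family p"
  shows "\<exists>D. (\<forall>x z. ((\<lambda>y. p y z) has_derivative (\<lambda>h. D x h z)) (at x)) \<and> (\<forall>h. poly_family (\<lambda>x. D x h))"
  using assms
proof (induction rule: poly_family.induct)
  case (const c)
  show ?case by (intro exI[of _ "\<lambda>x h z. 0"]) (auto intro: poly_family.const)
next
  case (linear L)
  then show ?case
    by (intro exI[of _ "\<lambda>x h z. L h"])
       (auto intro: poly_family.const bounded_linear_imp_has_derivative)
next
  case (coord a)
  show ?case by (intro exI[of _ "\<lambda>x h z. 0"]) (auto intro: poly_family.const)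
next
  case (add p q)
  then obtain D E where D: "\<And>x z. ((\<lambda>y. p y z) has_derivative (\<lambda>h. D x h z)) (at x)" "\<And>h. poly_family (\<lambda>x. D x h)"
    and E: "\<And>x z. ((\<lambda>y. q y z) has_derivative (\<lambda>h. E x h z)) (at x)" "\<And>h. poly_family (\<lambda>x. E x h)"
    by meson
  show ?case
    by (intro exI[of _ "\<lambda>x h z. D x h z + E x h z"]) (auto intro!: poly_family.add D E has_derivative_add)
next
  case (mult p q)
  then obtain D E where D: "\<And>x z. ((\<lambda>y. p y z) has_derivative (\<lambda>h. D x h z)) (at x)" "\<And>h. poly_family (\<lambda>x. D x h)"
    and E: "\<And>x z. ((\<lambda>y. q y z) has_derivative (\<lambda>h. E x h z)) (at x)" "\<And>h. poly_family (\<lambda>x. E x h)"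
    by meson
  show ?case
    by (intro exI[of _ "\<lambda>x h z. p x z * E x h z + D x h z * q x z"])
       (auto intro!: poly_family.add poly_family.mult D E mult.hyps has_derivative_mult)
qed

section \<open>Growth bounds locally uniform in the parameter\<close>

text \<open>The bound has the shape of the envelope in \<open>fock_norm_bound\<close>. One constant
  K serves as factor and as rate; enlarging it handles sums and products.\<close>

definition tame :: "('a::real_normed_vector \<Rightarrow> complex ^ 'n \<Rightarrow> complex) \<Rightarrow> bool" where
  "tame \<phi> \<longleftrightarrow> (\<forall>R. \<exists>K\<ge>0. \<forall>x z. norm x \<le> R \<longrightarrow> cmod (\<phi> x z) \<le> K * exp (K * norm z))"

lemma tame_add:
  assumes "tame \<phi>" "tame \<psi>"
  shows "tame (\<lambda>x z. \<phi> x z + \<psi> x z)"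
  unfolding tame_def
proof
  fix R
  obtain K L where K: "K \<ge> 0" "\<And>x z. norm x \<le> R \<Longrightarrow> cmod (\<phi> x z) \<le> K * exp (K * norm z)"
    and L: "L \<ge> 0" "\<And>x z. norm x \<le> R \<Longrightarrow> cmod (\<psi> x z) \<le> L * exp (L * norm z)"
    using assms unfolding tame_def by meson
  have "cmod (\<phi> x z + \<psi> x z) \<le> (K + L) * exp ((K + L) * norm z)" if "norm x \<le> R" for x z
  proof -
    have "cmod (\<phi> x z + \<psi> x z) \<le> K * exp (K * norm z) + L * exp (L * norm z)"
      by (rule order_trans[OF norm_triangle_ineq add_mono[OF K(2)[OF that] L(2)[OF that]]])
    also have "\<dots> \<le> K * exp ((K + L) * norm z) + L * exp ((K + L) * norm z)"
      using K(1) L(1) by (intro add_mono mult_left_mono) (auto intro!: mult_right_mono)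
    finally show ?thesis by (simp add: distrib_right)
  qed
  then show "\<exists>K\<ge>0. \<forall>x z. norm x \<le> R \<longrightarrow> cmod (\<phi> x z + \<psi> x z) \<le> K * exp (K * norm z)"
    using K L by (intro exI[of _ "K + L"]) auto
qed

lemma tame_mult:
  assumes "tame \<phi>" "tame \<psi>"
  shows "tame (\<lambda>x z. \<phi> x z * \<psi> x z)"
  unfolding tame_def
proof
  fix R
  obtain K L where K: "K \<ge> 0" "\<And>x z. norm x \<le> R \<Longrightarrow> cmod (\<phi> x z) \<le> K * exp (K * norm z)"
    and L: "L \<ge> 0" "\<And>x z. norm x \<le> R \<Longrightarrow> cmod (\<psi> x z) \<le> L * exp (L * norm z)"
    using assms unfolding tame_def by meson
  \<comment> \<open>M has to dominate the product of the factors and the sum of the rates at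
    once.\<close>
  define M where "M = K * L + (K + L)"
  have M: "K * L \<le> M" "K + L \<le> M" "0 \<le> M" using K L by (auto simp: M_def)
  have "cmod (\<phi> x z * \<psi> x z) \<le> M * exp (M * norm z)" if "norm x \<le> R" for x z
  proof -
    have "cmod (\<phi> x z * \<psi> x z) \<le> (K * exp (K * norm z)) * (L * exp (L * norm z))"
      unfolding norm_mult using K(1) by (intro mult_mono K(2)[OF that] L(2)[OF that]) auto
    also have "\<dots> = (K * L) * exp ((K + L) * norm z)"
      by (simp add: exp_add algebra_simps)
    also have "\<dots> \<le> M * exp (M * norm z)"
      using K L M by (intro mult_mono) (auto intro!: mult_right_mono)
    finally show ?thesis .
  qed
  then show "\<exists>K\<ge>0. \<forall>x z. norm x \<le> R \<longrightarrow> cmod (\<phi> x z * \<psi> x z) \<le> K * exp (K * norm z)"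
    using M by (intro exI[of _ M]) auto
qed

lemma poly_family_tame: "poly_family p \<Longrightarrow> tame p"
proof (induction rule: poly_family.induct)
  case (const c)
  have "cmod c \<le> cmod c * exp (cmod c * norm z)" for z :: "complex ^ 'n"
    by (simp add: mult_le_cancel_left1)
  then show ?case unfolding tame_def by (intro allI exI[of _ "cmod c"]) auto
next
  case (linear L)
  show ?case unfolding tame_def
  proof
    fix R
    obtain B where B: "B > 0" "\<And>x. norm (L x) \<le> norm x * B"
      using linear.hyps bounded_linear.pos_bounded by blast
    have "cmod (L x) \<le> B * \<bar>R\<bar> * exp (B * \<bar>R\<bar> * norm z)" if "norm x \<le> R" for x and z :: "complex ^ 'n"
    proof -
      have "cmod (L x) \<le> \<bar>R\<bar> * B"
        using B(2)[of x] B(1) that by (smt (verit) mult_right_mono)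
      also have "\<dots> = B * \<bar>R\<bar> * 1" by simp
      also have "\<dots> \<le> B * \<bar>R\<bar> * exp (B * \<bar>R\<bar> * norm z)"
        using B(1) by (intro mult_left_mono) auto
      finally show ?thesis .
    qed
    then show "\<exists>K\<ge>0. \<forall>x (z :: complex ^ 'n). norm x \<le> R \<longrightarrow> cmod (L x) \<le> K * exp (K * norm z)"
      using B(1) by (intro exI[of _ "B * \<bar>R\<bar>"]) auto
  qed
next
  case (coord a)
  have "cmod (scalar_product a z) \<le> (norm a + 1) * exp ((norm a + 1) * norm z)" for z
  proof -
    have "norm z \<le> exp (norm z)" using exp_ge_add_one_self[of "norm z"] by linarith
    also have "\<dots> \<le> exp ((norm a + 1) * norm z)" by (simp add: distrib_right)
    finally have "norm z \<le> exp ((norm a + 1) * norm z)" .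
    then have "norm a * norm z \<le> (norm a + 1) * exp ((norm a + 1) * norm z)"
      by (intro mult_mono) auto
    then show ?thesis using norm_scalar_product_le[of a z] by linarith
  qed
  then show ?case unfolding tame_def by (intro allI exI[of _ "norm a + 1"]) auto
qed (auto intro: tame_add tame_mult)

text \<open>Linear in z but with arbitrary dependence on the bound for x, so exponents quadratic in
  x qualify. Linearity in z keeps the exponential below the Gaussian for every positive
  \<open>lam\<close>.\<close>

definition linear_growth :: "('a::real_normed_vector \<Rightarrow> complex ^ 'n \<Rightarrow> complex) \<Rightarrow> bool" where
  "linear_growth q \<longleftrightarrow> (\<forall>R. \<exists>c\<ge>0. \<forall>x z. norm x \<le> R \<longrightarrow> cmod (q x z) \<le> c * (1 + norm z))"

lemma linear_growth_add:
  assumes "linear_growth p" "linear_growth q"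
  shows "linear_growth (\<lambda>x z. p x z + q x z)"
  unfolding linear_growth_def
proof
  fix R
  obtain K L where K: "K \<ge> 0" "\<And>x z. norm x \<le> R \<Longrightarrow> cmod (p x z) \<le> K * (1 + norm z)"
    and L: "L \<ge> 0" "\<And>x z. norm x \<le> R \<Longrightarrow> cmod (q x z) \<le> L * (1 + norm z)"
    using assms unfolding linear_growth_def by meson
  have "cmod (p x z + q x z) \<le> (K + L) * (1 + norm z)" if "norm x \<le> R" for x z
    using norm_triangle_ineq[of "p x z" "q x z"] K(2)[OF that, of z] L(2)[OF that, of z]
    by (simp add: distrib_right)
  then show "\<exists>c\<ge>0. \<forall>x z. norm x \<le> R \<longrightarrow> cmod (p x z + q x z) \<le> c * (1 + norm z)"
    using K L by (intro exI[of _ "K + L"]) auto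
qed

lemma linear_growth_indep:
  assumes "\<And>R. \<exists>c\<ge>0. \<forall>x. norm x \<le> R \<longrightarrow> cmod (g x) \<le> c"
  shows "linear_growth (\<lambda>x z. g x)"
  unfolding linear_growth_def
proof
  fix R
  obtain c where c: "c \<ge> 0" "\<And>x. norm x \<le> R \<Longrightarrow> cmod (g x) \<le> c" using assms by meson
  have "cmod (g x) \<le> c * (1 + norm z)" if "norm x \<le> R" for x and z :: "complex ^ 'b"
  proof -
    have "c * 1 \<le> c * (1 + norm z)" using c(1) by (intro mult_left_mono) auto
    then show ?thesis using c(2)[OF that] by simp
  qed
  then show "\<exists>c\<ge>0. \<forall>x (z :: complex ^ 'b). norm x \<le> R \<longrightarrow> cmod (g x) \<le> c * (1 + norm z)"
    using c(1) by blast
qed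

lemma tame_exp:
  assumes "linear_growth q"
  shows "tame (\<lambda>x z. exp (q x z))"
  unfolding tame_def
proof
  fix R
  obtain c where c: "c \<ge> 0" "\<And>x z. norm x \<le> R \<Longrightarrow> cmod (q x z) \<le> c * (1 + norm z)"
    using assms unfolding linear_growth_def by meson
  have ce: "c \<le> exp c" using exp_ge_add_one_self[of c] by linarith
  have "cmod (exp (q x z)) \<le> exp c * exp (exp c * norm z)" if "norm x \<le> R" for x z
  proof -
    have "cmod (exp (q x z)) \<le> exp (c * (1 + norm z))"
      using norm_exp[of "q x z"] c(2)[OF that, of z] by (meson exp_le_cancel_iff order_trans)
    also have "\<dots> = exp c * exp (c * norm z)" by (simp add: distrib_left exp_add)
    also have "\<dots> \<le> exp c * exp (exp c * norm z)"
      using ce by (intro mult_left_mono) (auto intro!: mult_right_mono)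
    finally show ?thesis .
  qed
  then show "\<exists>K\<ge>0. \<forall>x z. norm x \<le> R \<longrightarrow> cmod (exp (q x z)) \<le> K * exp (K * norm z)"
    by (intro exI[of _ "exp c"]) auto
qed

section \<open>Exponential families and their differentiability in the Fock norm\<close>

text \<open>The exponent stays fixed while the polynomial factor varies: a derivative in x replaces
  p by Dp + p Dq. The class is therefore closed under differentiation, and all orders of smoothness
  follow by induction.\<close>

definition exp_family ::
  "('a::euclidean_space \<Rightarrow> complex ^ 'n \<Rightarrow> complex) \<Rightarrow> ('a \<Rightarrow> complex ^ 'n \<Rightarrow> complex) \<Rightarrow> bool" where
  "exp_family q \<phi> \<longleftrightarrow> (\<exists>p. poly_family p \<and> \<phi> = (\<lambda>x z. p x z * exp (q x z)))"

lemma exp_family_holomorphic: "poly_family q \<Longrightarrow> exp_family q \<phi> \<Longrightarrow> holomorphic_Cn (\<phi> x)"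
  unfolding exp_family_def
  using holomorphic_Cn_mult[OF poly_family_holomorphic holomorphic_Cn_exp[OF poly_family_holomorphic]] by blast

lemma exp_family_tame: "linear_growth q \<Longrightarrow> exp_family q \<phi> \<Longrightarrow> tame \<phi>"
  unfolding exp_family_def using tame_mult[OF poly_family_tame tame_exp] by blast

lemma exp_family_deriv:
  assumes q: "poly_family q" and \<phi>: "exp_family q \<phi>"
  shows "\<exists>D. (\<forall>x z. ((\<lambda>y. \<phi> y z) has_derivative (\<lambda>h. D x h z)) (at x)) \<and> (\<forall>h. exp_family q (\<lambda>x. D x h))"
proof -
  obtain p where p: "poly_family p" and \<phi>_eq: "\<phi> = (\<lambda>x z. p x z * exp (q x z))"
    using \<phi> by (auto simp: exp_family_def)
  obtain D where D: "\<And>x z. ((\<lambda>y. p y z) has_derivative (\<lambda>h. D x h z)) (at x)" "\<And>h. poly_family (\<lambda>x. D x h)"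
    using poly_family_deriv[OF p] by meson
  obtain E where E: "\<And>x z. ((\<lambda>y. q y z) has_derivative (\<lambda>h. E x h z)) (at x)" "\<And>h. poly_family (\<lambda>x. E x h)"
    using poly_family_deriv[OF q] by meson
  have "((\<lambda>y. \<phi> y z) has_derivative (\<lambda>h. (D x h z + p x z * E x h z) * exp (q x z))) (at x)" for x z
    using has_derivative_mult[OF D(1)[of z x] has_derivative_compose[OF E(1)[of z x]
        DERIV_exp[THEN has_field_derivative_imp_has_derivative]]]
    unfolding \<phi>_eq by (rule has_derivative_eq_rhs) (simp add: fun_eq_iff algebra_simps)
  moreover have "exp_family q (\<lambda>x z. (D x h z + p x z * E x h z) * exp (q x z))" for h
    unfolding exp_family_def
    by (intro exI[of _ "\<lambda>x z. D x h z + p x z * E x h z"] conjI refl poly_family.add poly_family.mult p D E)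
  ultimately show ?thesis by (intro exI[of _ "\<lambda>x h z. (D x h z + p x z * E x h z) * exp (q x z)"]) auto
qed

text \<open>Mean value inequality on the unit ball around x, with an exponential envelope in z as
  the constant. The operator norm is estimated through basis directions because the growth bounds
  hold for a fixed direction.\<close>

lemma tame_lipschitz:
  fixes \<phi> :: "'a::euclidean_space \<Rightarrow> complex ^ 'n \<Rightarrow> complex"
  assumes D: "\<And>x z. ((\<lambda>y. \<phi> y z) has_derivative (\<lambda>h. D x h z)) (at x)"
    and tame: "\<And>b. b \<in> Basis \<Longrightarrow> tame (\<lambda>x. D x b)"
  shows "\<exists>K\<ge>0. \<forall>y z. norm (y - x) \<le> 1 \<longrightarrow> cmod (\<phi> y z - \<phi> x z) \<le> norm (y - x) * (K * exp (K * norm z))"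
proof -
  have "\<exists>K. \<forall>b\<in>Basis. K b \<ge> 0 \<and> (\<forall>y z. norm y \<le> norm x + 1 \<longrightarrow> cmod (D y b z) \<le> K b * exp (K b * norm z))"
    using tame unfolding tame_def by (intro bchoice) blast
  then obtain K where K: "\<And>b. b \<in> Basis \<Longrightarrow> K b \<ge> 0"
    "\<And>b y z. b \<in> Basis \<Longrightarrow> norm y \<le> norm x + 1 \<Longrightarrow> cmod (D y b z) \<le> K b * exp (K b * norm z)"
    by blast
  define M where "M = (\<Sum>b\<in>Basis. K b)"
  have M: "K b \<le> M" if "b \<in> Basis" for b
    unfolding M_def using that K(1) by (intro member_le_sum) auto
  have "cmod (\<phi> y z - \<phi> x z) \<le> norm (y - x) * (M * exp (M * norm z))" if y: "norm (y - x) \<le> 1" for y z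
  proof -
    have "norm (\<phi> y z - \<phi> x z) \<le> (M * exp (M * norm z)) * norm (y - x)"
    proof (rule differentiable_bound)
      fix w assume w: "w \<in> cball x 1"
      have nw: "norm w \<le> norm x + 1"
        using w norm_triangle_ineq2[of w x] by (simp add: dist_norm norm_minus_commute)
      show "((\<lambda>y. \<phi> y z) has_derivative (\<lambda>h. D w h z)) (at w within cball x 1)"
        using D by (rule has_derivative_at_withinI)
      have "onorm (\<lambda>h. D w h z) \<le> (\<Sum>b\<in>Basis. cmod (D w b z))"
        using D has_derivative_bounded_linear by (intro onorm_componentwise) blast
      also have "\<dots> \<le> (\<Sum>b\<in>Basis. K b * exp (M * norm z))"
      proof (rule sum_mono)
        fix b :: 'a assume b: "b \<in> Basis"
        have "K b * exp (K b * norm z) \<le> K b * exp (M * norm z)"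
          using K(1)[OF b] M[OF b] by (intro mult_left_mono) (auto intro!: mult_right_mono)
        then show "cmod (D w b z) \<le> K b * exp (M * norm z)"
          using K(2)[OF b nw, of z] by linarith
      qed
      finally show "onorm (\<lambda>h. D w h z) \<le> M * exp (M * norm z)"
        by (simp add: M_def sum_distrib_right)
    qed (use y in \<open>auto simp: dist_norm norm_minus_commute\<close>)
    then show ?thesis by (simp add: mult.commute)
  qed
  moreover have "M \<ge> 0" unfolding M_def by (intro sum_nonneg K(1))
  ultimately show ?thesis by blast
qed

context
  fixes lam :: real
  assumes lam: "lam > 0"
begin

lemma exp_family_in_fock:
  assumes "poly_family q" "linear_growth q" "exp_family q \<phi>"
  shows "\<phi> x \<in> fock lam"
proof -
  obtain K where "\<And>z. cmod (\<phi> x z) \<le> K * exp (K * norm z)"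
    using exp_family_tame[OF assms(2,3)] unfolding tame_def by (meson order_refl)
  then show ?thesis using exp_family_holomorphic[OF assms(1,3)] by (rule fock_of_bound[OF lam, rotated])
qed

lemma exp_family_norm_tendsto:
  assumes q: "poly_family q" "linear_growth q" and \<phi>: "exp_family q \<phi>"
  shows "((\<lambda>y. fock_norm lam (\<lambda>z. \<phi> y z - \<phi> x z)) \<longlongrightarrow> 0) (at x)"
proof -
  obtain D where D: "\<And>x z. ((\<lambda>y. \<phi> y z) has_derivative (\<lambda>h. D x h z)) (at x)" "\<And>h. exp_family q (\<lambda>x. D x h)"
    using exp_family_deriv[OF q(1) \<phi>] by meson
  obtain K where K: "K \<ge> 0" "\<And>y z. norm (y - x) \<le> 1 \<Longrightarrow> cmod (\<phi> y z - \<phi> x z) \<le> norm (y - x) * (K * exp (K * norm z))"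
    using tame_lipschitz[OF D(1) exp_family_tame[OF q(2) D(2)], of x] by meson
  obtain M where M: "M \<ge> 0" "\<And>(f :: complex ^ 'b \<Rightarrow> complex) c. c \<ge> 0 \<Longrightarrow> f \<in> fock lam \<Longrightarrow>
      (\<And>z. cmod (f z) \<le> c * (K * exp (K * norm z))) \<Longrightarrow> fock_norm lam f \<le> c * M"
    using fock_norm_bound[OF lam, where 'n = 'b, of K] by meson
  have "eventually (\<lambda>y. norm (y - x) < 1) (at x)"
    using eventually_at_ball[of 1 x UNIV] by (simp add: dist_norm norm_minus_commute)
  then have "eventually (\<lambda>y. norm (fock_norm lam (\<lambda>z. \<phi> y z - \<phi> x z)) \<le> norm (y - x) * M) (at x)"
  proof eventually_elim
    case (elim y)
    have "fock_norm lam (\<lambda>z. \<phi> y z - \<phi> x z) \<le> norm (y - x) * M"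
      using elim by (intro M(2) K(2) fock_diff[OF lam] exp_family_in_fock[OF q \<phi>]) auto
    then show ?case by (simp add: fock_norm_def)
  qed
  moreover have "((\<lambda>y. norm (y - x) * M) \<longlongrightarrow> 0) (at x)"
    by (auto intro!: tendsto_eq_intros)
  ultimately show ?thesis by (rule Lim_null_comparison)
qed

text \<open>The Lipschitz bound for the derivatives makes the Taylor remainder quadratic in y - x
  with an envelope in z of finite Fock norm. So the pointwise derivative is a derivative in the Fock
  norm.\<close>

lemma exp_family_has_derivative:
  assumes q: "poly_family q" "linear_growth q" and \<phi>: "exp_family q \<phi>"
    and D: "\<And>x z. ((\<lambda>y. \<phi> y z) has_derivative (\<lambda>h. D x h z)) (at x)"
  shows "fock_has_derivative lam \<phi> (D x) x"
proof -
  obtain D0 where D0: "\<And>x z. ((\<lambda>y. \<phi> y z) has_derivative (\<lambda>h. D0 x h z)) (at x)" "\<And>h. exp_family q (\<lambda>x. D0 x h)"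
    using exp_family_deriv[OF q(1) \<phi>] by meson
  \<comment> \<open>\<open>D\<close> is given by its pointwise property; uniqueness lets it inherit
    membership in the exponential family.\<close>
  have "D0 = D"
    using has_derivative_unique[OF D D0(1)] by (metis ext)
  note D2 = D0(2)[unfolded \<open>D0 = D\<close>]
  have "\<exists>K\<ge>0. \<forall>y z. norm (y - x) \<le> 1 \<longrightarrow> cmod (D y b z - D x b z) \<le> norm (y - x) * (K * exp (K * norm z))" for b
  proof -
    obtain E where E: "\<And>x z. ((\<lambda>y. D y b z) has_derivative (\<lambda>h. E x h z)) (at x)" "\<And>h. exp_family q (\<lambda>x. E x h)"
      using exp_family_deriv[OF q(1) D2] by meson
    show ?thesis by (rule tame_lipschitz[OF E(1) exp_family_tame[OF q(2) E(2)]])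
  qed
  then obtain K where K: "\<And>b. K b \<ge> 0"
    "\<And>b y z. norm (y - x) \<le> 1 \<Longrightarrow> cmod (D y b z - D x b z) \<le> norm (y - x) * (K b * exp (K b * norm z))"
    by metis
  define L where "L = (\<Sum>b\<in>Basis. K b)"
  have L: "K b \<le> L" if "b \<in> Basis" for b
    unfolding L_def using that K(1) by (intro member_le_sum) auto
  obtain M where M: "M \<ge> 0" "\<And>(f :: complex ^ 'b \<Rightarrow> complex) c. c \<ge> 0 \<Longrightarrow> f \<in> fock lam \<Longrightarrow>
      (\<And>z. cmod (f z) \<le> c * (L * exp (L * norm z))) \<Longrightarrow> fock_norm lam f \<le> c * M"
    using fock_norm_bound[OF lam, where 'n = 'b, of L] by meson
  have blin: "bounded_linear (\<lambda>h. D w h z)" for w z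
    using D has_derivative_bounded_linear by blast
  have rem: "cmod (\<phi> y z - \<phi> x z - D x (y - x) z) \<le> (norm (y - x))\<^sup>2 * (L * exp (L * norm z))"
    if y: "norm (y - x) \<le> 1" for y z
  proof -
    define r where "r = norm (y - x)"
    \<comment> \<open>Subtracting the linear map \<open>D x\<close> leaves a function with
      derivative \<open>D w - D x\<close>, which is of order r on the ball of radius r; a second
      factor r comes from the mean value inequality.\<close>
    have "norm ((\<phi> y z - D x y z) - (\<phi> x z - D x x z)) \<le> (r * (L * exp (L * norm z))) * norm (y - x)"
    proof (rule differentiable_bound)
      fix w assume "w \<in> cball x r"
      then have w: "norm (w - x) \<le> r" by (simp add: dist_norm norm_minus_commute)
      show "((\<lambda>y. \<phi> y z - D x y z) has_derivative (\<lambda>h. D w h z - D x h z)) (at w within cball x r)"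
        by (intro has_derivative_at_withinI[OF D] has_derivative_diff bounded_linear_imp_has_derivative blin)
      have "onorm (\<lambda>h. D w h z - D x h z) \<le> (\<Sum>b\<in>Basis. cmod (D w b z - D x b z))"
        by (intro onorm_componentwise bounded_linear_sub blin)
      also have "\<dots> \<le> (\<Sum>b\<in>Basis. r * (K b * exp (L * norm z)))"
      proof (rule sum_mono)
        fix b :: 'a assume b: "b \<in> Basis"
        have "cmod (D w b z - D x b z) \<le> norm (w - x) * (K b * exp (K b * norm z))"
          using w y by (intro K(2)) (simp add: r_def)
        also have "\<dots> \<le> r * (K b * exp (L * norm z))"
          using K(1)[of b] L[OF b] w by (intro mult_mono mult_left_mono) (auto simp: r_def intro!: mult_right_mono)
        finally show "cmod (D w b z - D x b z) \<le> r * (K b * exp (L * norm z))" .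
      qed
      finally show "onorm (\<lambda>h. D w h z - D x h z) \<le> r * (L * exp (L * norm z))"
        by (simp add: L_def sum_distrib_right sum_distrib_left)
    qed (auto simp: r_def dist_norm norm_minus_commute)
    moreover have Ddiff: "D x (y - x) z = D x y z - D x x z"
      using linear_diff[OF bounded_linear.linear[OF blin]] .
    moreover have "\<phi> y z - \<phi> x z - D x (y - x) z = (\<phi> y z - D x y z) - (\<phi> x z - D x x z)"
      unfolding Ddiff by simp
    ultimately show ?thesis by (simp only: r_def power2_eq_square mult_ac)
  qed
  have fock: "(\<lambda>z. \<phi> y z - \<phi> x z - D x h z) \<in> fock lam" for y h
    by (intro fock_diff[OF lam] exp_family_in_fock[OF q \<phi>] exp_family_in_fock[OF q D2])
  have "eventually (\<lambda>y. norm (y - x) < 1 \<and> y \<noteq> x) (at x)"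
    using eventually_at_ball[of 1 x UNIV] by (intro eventually_conj) (simp_all add: dist_norm norm_minus_commute eventually_at_filter)
  then have "eventually (\<lambda>y. norm (fock_norm lam (\<lambda>z. \<phi> y z - \<phi> x z - D x (y - x) z) / norm (y - x)) \<le> norm (y - x) * M) (at x)"
  proof eventually_elim
    case (elim y)
    have "fock_norm lam (\<lambda>z. \<phi> y z - \<phi> x z - D x (y - x) z) \<le> (norm (y - x))\<^sup>2 * M"
      using elim by (intro M(2) fock rem) auto
    then show ?case using elim by (simp add: fock_norm_def field_simps power2_eq_square)
  qed
  moreover have "((\<lambda>y. norm (y - x) * M) \<longlongrightarrow> 0) (at x)"
    by (auto intro!: tendsto_eq_intros)
  ultimately have "((\<lambda>y. fock_norm lam (\<lambda>z. \<phi> y z - \<phi> x z - D x (y - x) z) / norm (y - x)) \<longlongrightarrow> 0) (at x)"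
    by (rule Lim_null_comparison)
  then show ?thesis
    unfolding fock_has_derivative_def
    using exp_family_in_fock[OF q D2] bounded_linear.linear[OF blin] by blast
qed

lemma exp_family_fock_Ck:
  assumes q: "poly_family q" "linear_growth q"
  shows "exp_family q \<phi> \<Longrightarrow> fock_Ck lam k \<phi>"
proof (induction k arbitrary: \<phi>)
  case 0
  then show ?case by (simp add: exp_family_in_fock[OF q] exp_family_norm_tendsto[OF q])
next
  case (Suc k)
  obtain D where D: "\<And>x z. ((\<lambda>y. \<phi> y z) has_derivative (\<lambda>h. D x h z)) (at x)" "\<And>h. exp_family q (\<lambda>x. D x h)"
    using exp_family_deriv[OF q(1) Suc.prems] by meson
  show ?case
    using exp_family_in_fock[OF q Suc.prems] exp_family_has_derivative[OF q Suc.prems D(1)] Suc.IH[OF D(2)]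
    by auto
qed

end

text \<open>In coordinates the conjugates are real-linear in x, which the constructor
  \<open>linear\<close> admits.\<close>

lemma poly_family_scalar_product_cnj:
  fixes L :: "'a::euclidean_space \<Rightarrow> complex ^ 'n"
  assumes L: "bounded_linear L"
  shows "poly_family (\<lambda>x z. scalar_product (vcnj (L x)) z)"
proof -
  have "poly_family (\<lambda>x z. \<Sum>j\<in>UNIV. cnj (L x $ j) * scalar_product (axis j 1) z)"
  proof (intro poly_family_sum poly_family.mult poly_family.coord poly_family.linear)
    fix j show "bounded_linear (\<lambda>x. cnj (L x $ j))"
      by (intro bounded_linear_compose[OF bounded_linear_cnj]
          bounded_linear_compose[OF bounded_linear_vec_nth] L)
  qed
  moreover have "scalar_product (axis j 1) z = z $ j" for j and z :: "complex ^ 'n"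
    using scalar_product_axis[of z j 1] by (simp add: scalar_product_commute)
  ultimately show ?thesis by (simp add: scalar_product_def)
qed

lemma norm_vcnj [simp]: "norm (vcnj z) = norm z"
  by (simp add: norm_vec_def)

lemma linear_growth_scalar_product:
  assumes b: "bounded_linear L"
  shows "linear_growth (\<lambda>x z. scalar_product (vcnj (L x)) z)"
  unfolding linear_growth_def
proof
  fix R
  obtain B where B: "B > 0" "\<And>x. norm (L x) \<le> norm x * B"
    using b bounded_linear.pos_bounded by blast
  have "cmod (scalar_product (vcnj (L x)) z) \<le> \<bar>R\<bar> * B * (1 + norm z)" if "norm x \<le> R" for x z
  proof -
    have "cmod (scalar_product (vcnj (L x)) z) \<le> norm (L x) * norm z"
      using norm_scalar_product_le[of "vcnj (L x)" z] by simp
    also have "\<dots> \<le> (\<bar>R\<bar> * B) * (1 + norm z)"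
      using B that by (intro mult_mono order_trans[OF B(2)]) auto
    finally show ?thesis .
  qed
  then show "\<exists>c\<ge>0. \<forall>x z. norm x \<le> R \<longrightarrow> cmod (scalar_product (vcnj (L x)) z) \<le> c * (1 + norm z)"
    using B(1) by (intro exI[of _ "\<bar>R\<bar> * B"]) auto
qed

lemma linear_growth_cmult:
  assumes "linear_growth q"
  shows "linear_growth (\<lambda>x z. c * q x z)"
  unfolding linear_growth_def
proof
  fix R
  obtain K where K: "K \<ge> 0" "\<And>x z. norm x \<le> R \<Longrightarrow> cmod (q x z) \<le> K * (1 + norm z)"
    using assms unfolding linear_growth_def by meson
  then show "\<exists>K\<ge>0. \<forall>x z. norm x \<le> R \<longrightarrow> cmod (c * q x z) \<le> K * (1 + norm z)"
    by (intro exI[of _ "cmod c * K"]) (auto simp: norm_mult mult.assoc intro!: mult_left_mono)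
qed

text \<open>Covers the part of an exponent that is free of z, such as the term in |x|^2, by
  compactness of balls.\<close>

lemma linear_growth_continuous:
  fixes g :: "'a::euclidean_space \<Rightarrow> complex"
  assumes "continuous_on UNIV g"
  shows "linear_growth (\<lambda>x z. g x)"
proof (rule linear_growth_indep)
  fix R
  have "bounded (g ` cball 0 R)"
    using assms by (intro compact_imp_bounded compact_continuous_image) (auto intro: continuous_on_subset)
  then obtain c where "c > 0" "\<forall>y\<in>g ` cball 0 R. norm y \<le> c" by (auto simp: bounded_pos)
  then show "\<exists>c\<ge>0. \<forall>x. norm x \<le> R \<longrightarrow> cmod (g x) \<le> c" by (intro exI[of _ c]) auto
qed

subsection \<open>Differentiation of curves\<close>

text \<open>The shape of every scalar factor met along \<open>t *\<^sub>R u\<close>: the quadratic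
  term comes from the squared norm and disappears at 0.\<close>

lemma has_vector_derivative_exp_quadratic:
  "((\<lambda>t. exp (s * complex_of_real t + p * (complex_of_real t)\<^sup>2)) has_vector_derivative s) (at 0)"
proof -
  have "((\<lambda>t. exp (s * t + p * t\<^sup>2)) has_field_derivative s) (at (complex_of_real 0))"
    by (auto intro!: derivative_eq_intros)
  then show ?thesis by (rule has_vector_derivative_real_field)
qed

lemma has_vector_derivative_line:
  fixes f :: "complex ^ 'n \<Rightarrow> complex"
  assumes "(f has_derivative scalar_product d) (at z)"
  shows "((\<lambda>t. f (z + t *\<^sub>R h)) has_vector_derivative scalar_product d h) (at 0)"
proof -
  have "((\<lambda>t. z + t *\<^sub>R h) has_derivative (\<lambda>t. t *\<^sub>R h)) (at (0::real))"
    by (auto intro!: derivative_eq_intros)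
  moreover have "(f has_derivative scalar_product d) (at (z + 0 *\<^sub>R h))" using assms by simp
  ultimately have "((\<lambda>t. f (z + t *\<^sub>R h)) has_derivative (\<lambda>t. scalar_product d (t *\<^sub>R h))) (at 0)"
    by (rule has_derivative_compose)
  then show ?thesis by (simp add: has_vector_derivative_def scaleR_conv_of_real[where 'a = complex])
qed

text \<open>Cauchy-Riemann: the partial derivative in the imaginary direction is i times the one in
  the real direction.\<close>

lemma wirtinger_eq:
  assumes "(f has_derivative scalar_product d) (at z)"
  shows "wirtinger j f z = d $ j"
  using has_vector_derivative_line[OF assms, THEN vector_derivative_at]
  by (simp add: wirtinger_def partial_re_def partial_im_def complex_eq_iff)

lemma wirtinger_cmult:
  assumes "holomorphic_Cn f"
  shows "wirtinger j (\<lambda>z. c * f z) z = c * wirtinger j f z"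
proof -
  obtain d where d: "(f has_derivative scalar_product d) (at z)"
    using assms by (meson holomorphic_Cn_def)
  then have "((\<lambda>z. c * f z) has_derivative scalar_product (c *s d)) (at z)"
    by (rule has_derivative_eq_rhs[OF has_derivative_mult_right]) (simp add: fun_eq_iff)
  then show ?thesis using d by (simp add: wirtinger_eq)
qed

text \<open>Links \<open>drho\<close> with the group. It holds pointwise for every holomorphic
  function, so it applies to the image of a smooth vector under the unitary operator as
  well.\<close>

lemma weyl_has_vector_derivative:
  assumes "holomorphic_Cn f"
  shows "((\<lambda>t. weyl lam (t *\<^sub>R a) f z) has_vector_derivative drho lam ((a, vcnj a), 0) f z) (at 0)"
proof -
  obtain d where d: "(f has_derivative scalar_product d) (at z)"
    using assms by (meson holomorphic_Cn_def)
  have "((\<lambda>t. exp (complex_of_real lam / 2 * scalar_product (vcnj a) z * complex_of_real t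
       + (- complex_of_real (lam / 4 * (norm a)\<^sup>2)) * (complex_of_real t)\<^sup>2) * f (z + t *\<^sub>R (- a)))
     has_vector_derivative exp (complex_of_real lam / 2 * scalar_product (vcnj a) z * complex_of_real 0
       + (- complex_of_real (lam / 4 * (norm a)\<^sup>2)) * (complex_of_real 0)\<^sup>2) * scalar_product d (- a)
     + complex_of_real lam / 2 * scalar_product (vcnj a) z * f (z + 0 *\<^sub>R (- a))) (at 0)"
    by (intro has_vector_derivative_mult has_vector_derivative_exp_quadratic has_vector_derivative_line d)
  moreover have "(\<lambda>t. exp (complex_of_real lam / 2 * scalar_product (vcnj a) z * complex_of_real t
       + (- complex_of_real (lam / 4 * (norm a)\<^sup>2)) * (complex_of_real t)\<^sup>2) * f (z + t *\<^sub>R (- a)))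
     = (\<lambda>t. weyl lam (t *\<^sub>R a) f z)"
    by (auto simp: weyl_def power_mult_distrib mult_ac)
  ultimately show ?thesis
    by (simp add: drho_def wirtinger_eq[OF d] scalar_product_def sum_negf mult_ac)
qed

lemma coherent_eq: "coherent lam w = (\<lambda>z. exp (complex_of_real lam / 2 * scalar_product (vcnj w) z))"
  by (simp add: coherent_def)

text \<open>A coherent state is an eigenfunction of each derivative in z; the multiplication term
  that remains is its derivative in w along the conjugate of v.\<close>

lemma drho_coherent:
  "drho lam ((u, v), 0) (coherent lam w) z = complex_of_real lam / 2 * scalar_product v z * coherent lam w z
     - complex_of_real lam / 2 * scalar_product u (vcnj w) * coherent lam w z"
proof -
  have "((\<lambda>z. complex_of_real lam / 2 * scalar_product (vcnj w) z) has_derivative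
      (\<lambda>h. complex_of_real lam / 2 * scalar_product (vcnj w) h)) (at z)"
    by (intro bounded_linear_imp_has_derivative bounded_linear_const_mult bounded_linear_scalar_product)
  from has_derivative_compose[OF this DERIV_exp[THEN has_field_derivative_imp_has_derivative]]
  have "(coherent lam w has_derivative scalar_product ((complex_of_real lam / 2 * coherent lam w z) *s vcnj w)) (at z)"
    unfolding coherent_eq by (rule has_derivative_eq_rhs) (simp add: fun_eq_iff)
  then have w: "wirtinger j (coherent lam w) z = complex_of_real lam / 2 * coherent lam w z * cnj (w $ j)" for j
    by (simp add: wirtinger_eq)
  show ?thesis
    by (simp add: drho_def w scalar_product_def sum_distrib_left sum_distrib_right sum_divide_distrib mult_ac)
qed

text \<open>The factor 1 gives the right side the form a f + b g in which linearity of a unitary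
  operator is stated.\<close>

lemma drho_central:
  "drho lam ((u, v), c) f = (\<lambda>z. (\<i> * complex_of_real lam * c) * f z + 1 * drho lam ((u, v), 0) f z)"
  by (simp add: drho_def fun_eq_iff algebra_simps)

lemma additive_homogeneous_expand:
  fixes R :: "complex ^ 'n \<Rightarrow> complex"
  assumes add: "\<And>x y. R (x + y) = R x + R y" and scale: "\<And>c x. R (c *s x) = c * R x"
  shows "R a = (\<Sum>j\<in>UNIV. a $ j * R (axis j 1))"
proof -
  have "R 0 = 0" using scale[of 0 0] by simp
  have "R a = R (\<Sum>j\<in>UNIV. a $ j *s axis j 1)" by (simp add: basis_expansion)
  also have "\<dots> = (\<Sum>j\<in>UNIV. R (a $ j *s axis j 1))"
    using sum_comp_morphism[of R "\<lambda>j. a $ j *s axis j 1" UNIV] \<open>R 0 = 0\<close> add by (simp add: comp_def)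
  finally show ?thesis by (simp add: scale)
qed

text \<open>The lower blocks are the conjugates of the upper ones, so k preserves the real form and
  \<open>act k X\<close> again generates a group of Weyl operators.\<close>

lemma S_group_blocks:
  assumes "block_matrix A B C D \<in> S_group"
  shows "vcnj (A *v a + B *v vcnj a) = C *v a + D *v vcnj a"
proof -
  obtain P Q where eq: "block_matrix A B C D = block_matrix P Q (map_matrix cnj Q) (map_matrix cnj P)"
    using assms by (auto simp: S_group_def)
  have "A = P" "B = Q" "C = map_matrix cnj Q" "D = map_matrix cnj P"
    using arg_cong[OF eq, of "\<lambda>M. M $ Inl _ $ Inl _"] arg_cong[OF eq, of "\<lambda>M. M $ Inl _ $ Inr _"]
      arg_cong[OF eq, of "\<lambda>M. M $ Inr _ $ Inl _"] arg_cong[OF eq, of "\<lambda>M. M $ Inr _ $ Inr _"]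
    by (simp_all add: block_matrix_def vec_eq_iff)
  then show ?thesis
    by (simp add: vec_eq_iff matrix_vector_mult_def map_matrix_def add.commute)
qed

section \<open>Norm derivatives of curves in the Fock space\<close>

text \<open>\<open>g\<close> is the derivative of the curve at the parameter 0, in the Fock
  norm.\<close>

definition fock_curve_deriv ::
  "real \<Rightarrow> (real \<Rightarrow> complex ^ 'n \<Rightarrow> complex) \<Rightarrow> (complex ^ 'n \<Rightarrow> complex) \<Rightarrow> bool" where
  "fock_curve_deriv lam \<psi> g \<longleftrightarrow>
     ((\<lambda>t. fock_norm lam (\<lambda>z. \<psi> t z - \<psi> 0 z - complex_of_real t * g z) / \<bar>t\<bar>) \<longlongrightarrow> 0) (at 0)"

text \<open>The derivative of the coherent state in its label w along h. It is antilinear in h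
  because the label enters through its conjugate.\<close>

definition coherent_deriv :: "real \<Rightarrow> complex ^ 'n \<Rightarrow> complex ^ 'n \<Rightarrow> complex ^ 'n \<Rightarrow> complex" where
  "coherent_deriv lam w h = (\<lambda>z. complex_of_real lam / 2 * scalar_product (vcnj h) z * coherent lam w z)"

lemma coherent_deriv_add: "coherent_deriv lam w (x + y) = (\<lambda>z. coherent_deriv lam w x z + coherent_deriv lam w y z)"
  by (simp add: coherent_deriv_def fun_eq_iff algebra_simps)

lemma coherent_deriv_scale: "coherent_deriv lam w (c *s x) = (\<lambda>z. cnj c * coherent_deriv lam w x z)"
  by (simp add: coherent_deriv_def fun_eq_iff)

context
  fixes lam :: real
  assumes lam: "lam > 0"
begin

lemma fock_has_derivative_curve:
  assumes D: "fock_has_derivative lam \<phi> D x"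
  shows "fock_curve_deriv lam (\<lambda>t. \<phi> (x + t *\<^sub>R h)) (D h)"
proof -
  have lin: "linear (\<lambda>h. D h z)" for z using D by (simp add: fock_has_derivative_def)
  show ?thesis
  \<comment> \<open>For h = 0 the line stays at x and does not tend to the punctured filter
    \<open>at x\<close>.\<close>
  proof (cases "h = 0")
    case True
    then show ?thesis
      using linear_0[OF lin] by (simp add: fock_curve_deriv_def fock_norm_def)
  next
    case False
    have Dt: "D (t *\<^sub>R h) z = complex_of_real t * D h z" for t z
      using linear_scale[OF lin, of t h] by (simp add: scaleR_conv_of_real)
    have "filterlim (\<lambda>t. x + t *\<^sub>R h) (at x) (at 0)"
      using False by (auto simp: filterlim_at eventually_at_filter intro!: tendsto_eq_intros)
    from filterlim_compose[OF conjunct2[OF conjunct2[OF D[unfolded fock_has_derivative_def]]] this]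
    have "((\<lambda>t. fock_norm lam (\<lambda>z. \<phi> (x + t *\<^sub>R h) z - \<phi> x z - complex_of_real t * D h z) / (\<bar>t\<bar> * norm h)) \<longlongrightarrow> 0) (at 0)"
      by (simp add: Dt)
    from tendsto_mult_right[OF this, of "norm h"] False show ?thesis
      by (simp add: fock_curve_deriv_def)
  qed
qed

text \<open>Product rule: insert the first-order expansions of both curves with remainders r and s.
  By Cauchy-Schwarz every term beyond the linear one is o(t).\<close>

lemma fock_inner_has_vector_derivative:
  assumes \<psi>: "\<And>t. \<psi> t \<in> fock lam" "g \<in> fock lam" "fock_curve_deriv lam \<psi> g"
    and \<eta>: "\<And>t. \<eta> t \<in> fock lam" "k \<in> fock lam" "fock_curve_deriv lam \<eta> k"
  shows "((\<lambda>t. fock_inner lam (\<psi> t) (\<eta> t)) has_vector_derivative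
     fock_inner lam g (\<eta> 0) + fock_inner lam (\<psi> 0) k) (at 0)"
proof -
  define r where "r = (\<lambda>t z. \<psi> t z - \<psi> 0 z - complex_of_real t * g z)"
  define s where "s = (\<lambda>t z. \<eta> t z - \<eta> 0 z - complex_of_real t * k z)"
  have r: "r t \<in> fock lam" for t unfolding r_def by (intro fock_diff[OF lam] fock_scale[OF lam] \<psi>)
  have s: "s t \<in> fock lam" for t unfolding s_def by (intro fock_diff[OF lam] fock_scale[OF lam] \<eta>)
  define \<rho> where "\<rho> = (\<lambda>t. fock_norm lam (r t) / \<bar>t\<bar>)"
  define \<sigma> where "\<sigma> = (\<lambda>t. fock_norm lam (s t) / \<bar>t\<bar>)"
  have \<rho>: "(\<rho> \<longlongrightarrow> 0) (at 0)" using \<psi>(3) by (simp add: fock_curve_deriv_def \<rho>_def r_def)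
  have \<sigma>: "(\<sigma> \<longlongrightarrow> 0) (at 0)" using \<eta>(3) by (simp add: fock_curve_deriv_def \<sigma>_def s_def)
  define L where "L = fock_inner lam g (\<eta> 0) + fock_inner lam (\<psi> 0) k"
  let ?N = "fock_norm lam"
  \<comment> \<open>The sum of the bounds for the six error terms in \<open>expand\<close> below,
    divided by |t|.\<close>
  define B where "B = (\<lambda>t. \<rho> t * ?N (\<eta> 0) + \<bar>t\<bar> * \<rho> t * \<sigma> t + \<bar>t\<bar> * \<rho> t * ?N k
     + \<bar>t\<bar> * \<sigma> t * ?N g + \<bar>t\<bar> * (?N g * ?N k) + ?N (\<psi> 0) * \<sigma> t)"
  have "(B \<longlongrightarrow> 0) (at 0)"
    unfolding B_def by (auto intro!: tendsto_eq_intros \<rho> \<sigma>)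
  have bound: "cmod (fock_inner lam (\<psi> t) (\<eta> t) - fock_inner lam (\<psi> 0) (\<eta> 0) - t *\<^sub>R L) \<le> \<bar>t\<bar> * B t" if t: "t \<noteq> 0" for t
  proof -
    note simps = fock_inner_add_left[OF lam] fock_inner_diff_left[OF lam] fock_inner_diff_right[OF lam]
      fock_inner_scale_left[OF lam] fock_inner_scale_right[OF lam] fock_diff[OF lam] fock_scale[OF lam] \<psi>(1,2) \<eta>(1,2)
    have r_left: "fock_inner lam (r t) h = fock_inner lam (\<psi> t) h - fock_inner lam (\<psi> 0) h
        - complex_of_real t * fock_inner lam g h" if "h \<in> fock lam" for h
      unfolding r_def by (simp add: simps that)
    have s_right: "fock_inner lam h (s t) = fock_inner lam h (\<eta> t) - fock_inner lam h (\<eta> 0)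
        - complex_of_real t * fock_inner lam h k" if "h \<in> fock lam" for h
      unfolding s_def by (simp add: simps that)
    have expand: "fock_inner lam (\<psi> t) (\<eta> t) - fock_inner lam (\<psi> 0) (\<eta> 0) - t *\<^sub>R L
      = fock_inner lam (r t) (\<eta> 0) + fock_inner lam (r t) (s t) + complex_of_real t * fock_inner lam (r t) k
        + complex_of_real t * fock_inner lam g (s t) + (complex_of_real t)\<^sup>2 * fock_inner lam g k
        + fock_inner lam (\<psi> 0) (s t)"
      unfolding L_def by (simp add: r_left s_right s \<psi> \<eta> scaleR_conv_of_real algebra_simps power2_eq_square)
    have "cmod (fock_inner lam (\<psi> t) (\<eta> t) - fock_inner lam (\<psi> 0) (\<eta> 0) - t *\<^sub>R L)
      \<le> ?N (r t) * ?N (\<eta> 0) + ?N (r t) * ?N (s t) + \<bar>t\<bar> * (?N (r t) * ?N k)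
        + \<bar>t\<bar> * (?N g * ?N (s t)) + t\<^sup>2 * (?N g * ?N k) + ?N (\<psi> 0) * ?N (s t)"
      unfolding expand by (intro norm_triangle_le add_mono) (auto simp: norm_mult norm_power power_abs
          intro!: mult_left_mono fock_Cauchy_Schwarz[OF lam] r s \<psi> \<eta>)
    also have "\<dots> = \<bar>t\<bar> * B t"
    proof -
      have eqs: "?N (r t) = \<bar>t\<bar> * \<rho> t" "?N (s t) = \<bar>t\<bar> * \<sigma> t" "t\<^sup>2 = \<bar>t\<bar> * \<bar>t\<bar>"
        using t by (simp_all add: \<rho>_def \<sigma>_def power2_eq_square)
      show ?thesis unfolding eqs B_def by (simp only: distrib_left mult_ac)
    qed
    finally show ?thesis .
  qed
  have "eventually (\<lambda>t. norm ((fock_inner lam (\<psi> t) (\<eta> t) - fock_inner lam (\<psi> 0) (\<eta> 0) - t *\<^sub>R L) /\<^sub>R \<bar>t\<bar>) \<le> B t) (at 0)"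
    unfolding eventually_at_filter
  proof (intro always_eventually allI impI)
    fix t :: real assume "t \<noteq> 0"
    define X where "X = fock_inner lam (\<psi> t) (\<eta> t) - fock_inner lam (\<psi> 0) (\<eta> 0) - t *\<^sub>R L"
    have "cmod X \<le> \<bar>t\<bar> * B t" unfolding X_def by (rule bound) fact
    with \<open>t \<noteq> 0\<close> show "norm ((fock_inner lam (\<psi> t) (\<eta> t) - fock_inner lam (\<psi> 0) (\<eta> 0) - t *\<^sub>R L) /\<^sub>R \<bar>t\<bar>) \<le> B t"
      unfolding X_def[symmetric] by (simp add: field_simps)
  qed
  from Lim_null_comparison[OF this \<open>(B \<longlongrightarrow> 0) (at 0)\<close>] show ?thesis
    unfolding has_vector_derivative_def has_derivative_at2 L_def[symmetric]
    by (simp add: bounded_linear_scaleR_left inverse_eq_divide diff_diff_eq)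
qed

lemma fock_curve_deriv_const: "fock_curve_deriv lam (\<lambda>t. f) (\<lambda>z. 0)"
  by (simp add: fock_curve_deriv_def fock_norm_def)

text \<open>Product rule with the constant curve at a coherent state, followed by the reproducing
  formula. This is how an abstract norm derivative is recognised as a differential operator.\<close>

lemma fock_curve_deriv_pointwise:
  assumes "\<And>t. \<psi> t \<in> fock lam" "g \<in> fock lam" "fock_curve_deriv lam \<psi> g"
  shows "((\<lambda>t. \<psi> t z) has_vector_derivative g z) (at 0)"
proof -
  define N where "N = complex_of_real (measure (gauss lam :: (complex ^ 'a) measure) UNIV)"
  have N: "N \<noteq> 0" using measure_gauss_pos[OF lam, where 'n = 'a] by (simp add: N_def)
  have zero: "fock_inner lam (\<psi> 0) (\<lambda>z. 0) = 0" by (simp add: fock_inner_def)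
  have "((\<lambda>t. N * \<psi> t z) has_vector_derivative N * g z) (at 0)"
    using fock_inner_has_vector_derivative[OF assms coherent_in_fock[OF lam] fock_zero[OF lam] fock_curve_deriv_const, of z]
    by (simp add: fock_reproducing[OF lam] assms zero N_def)
  from has_vector_derivative_mult_right[OF this, of "inverse N"] N show ?thesis
    by (simp add: mult.assoc[symmetric])
qed

lemma coherent_has_derivative: "fock_has_derivative lam (coherent lam) (coherent_deriv lam w) w"
proof (rule exp_family_has_derivative[OF lam, where q = "\<lambda>w z. complex_of_real lam / 2 * scalar_product (vcnj w) z"])
  have idl: "bounded_linear (\<lambda>w::complex ^ 'a. w)" by (rule bounded_linear_ident)
  show "poly_family (\<lambda>w (z::complex ^ 'a). complex_of_real lam / 2 * scalar_product (vcnj w) z)"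
    by (rule poly_family.mult[OF poly_family.const poly_family_scalar_product_cnj[OF idl]])
  show "linear_growth (\<lambda>w (z::complex ^ 'a). complex_of_real lam / 2 * scalar_product (vcnj w) z)"
    by (rule linear_growth_cmult[OF linear_growth_scalar_product[OF idl]])
  show "exp_family (\<lambda>w (z::complex ^ 'a). complex_of_real lam / 2 * scalar_product (vcnj w) z) (coherent lam)"
    unfolding exp_family_def
    by (rule exI[of _ "\<lambda>x z. 1"]) (auto simp: coherent_def fun_eq_iff intro: poly_family.const)
  fix w z :: "complex ^ 'a"
  have "bounded_linear (\<lambda>w. complex_of_real lam * scalar_product (vcnj w) z / 2)"
    by (rule bounded_linear_intro[where K = "lam * norm z / 2"])
       (use lam norm_scalar_product_le[of "vcnj _" z] in
         \<open>auto simp: norm_mult norm_divide algebra_simps scaleR_conv_of_real[where 'a = complex] add_divide_distrib\<close>)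
  then have "((\<lambda>w. complex_of_real lam * scalar_product (vcnj w) z / 2) has_derivative
      (\<lambda>h. complex_of_real lam * scalar_product (vcnj h) z / 2)) (at w)"
    by (rule bounded_linear_imp_has_derivative)
  from has_derivative_compose[OF this DERIV_exp[THEN has_field_derivative_imp_has_derivative]]
  show "((\<lambda>w. coherent lam w z) has_derivative (\<lambda>h. coherent_deriv lam w h z)) (at w)"
    unfolding coherent_def coherent_deriv_def by (rule has_derivative_eq_rhs) (simp add: fun_eq_iff)
qed

lemma coherent_deriv_in_fock: "coherent_deriv lam w h \<in> fock lam"
  using coherent_has_derivative[of w] by (auto simp: fock_has_derivative_def)

lemma coherent_smooth: "coherent lam w \<in> smooth_vectors lam"
proof -
  \<comment> \<open>The part of the exponent free of z. It is quadratic in the group coordinates,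
    with |a|^2 written as a pairing so that it is visibly a polynomial in real-linear
    functionals.\<close>
  define q1 where "q1 = (\<lambda>(x :: (complex ^ 'a) \<times> real). \<i> * complex_of_real lam * complex_of_real (snd x)
     + (- (complex_of_real lam / 4)) * scalar_product (vcnj (fst x)) (fst x)
     + (- (complex_of_real lam / 2)) * scalar_product (vcnj w) (fst x))"
  define q where "q = (\<lambda>x (z :: complex ^ 'a). q1 x + complex_of_real lam / 2 * scalar_product (vcnj (fst x)) z
     + complex_of_real lam / 2 * scalar_product (vcnj w) z)"
  have b1: "bounded_linear (fst :: (complex ^ 'a) \<times> real \<Rightarrow> _)" by (rule bounded_linear_fst)
  have nth: "bounded_linear (\<lambda>x :: (complex ^ 'a) \<times> real. fst x $ j)" for j
    by (rule bounded_linear_compose[OF bounded_linear_vec_nth b1])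
  have cnth: "bounded_linear (\<lambda>x :: (complex ^ 'a) \<times> real. cnj (fst x $ j))" for j
    by (rule bounded_linear_compose[OF bounded_linear_cnj nth])
  have snd: "bounded_linear (\<lambda>x :: (complex ^ 'a) \<times> real. complex_of_real (snd x))"
    by (rule bounded_linear_compose[OF bounded_linear_of_real bounded_linear_snd])
  have "poly_family (\<lambda>x (z :: complex ^ 'a). q1 x)"
    unfolding q1_def scalar_product_def vcnj_simps
    by (intro poly_family.add poly_family.mult[OF poly_family.const poly_family_sum]
        poly_family.mult[OF poly_family.linear[OF cnth] poly_family.linear[OF nth]]
        poly_family.mult[OF poly_family.const poly_family.linear[OF nth]]
        poly_family.mult[OF poly_family.const poly_family.linear[OF snd]])
  then have poly: "poly_family q"
    unfolding q_def
    by (intro poly_family.add poly_family.mult[OF poly_family.const poly_family_scalar_product_cnj[OF b1]]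
        poly_family.mult[OF poly_family.const poly_family.coord])
  have "continuous_on UNIV q1"
    unfolding q1_def scalar_product_def vcnj_simps by (intro continuous_intros)
  then have lg1: "linear_growth (\<lambda>x (z :: complex ^ 'a). q1 x)"
    by (rule linear_growth_continuous)
  have lgw: "linear_growth (\<lambda>(x :: (complex ^ 'a) \<times> real) z. scalar_product (vcnj w) z)"
    unfolding linear_growth_def
  proof (intro allI exI[of _ "norm w"] conjI impI)
    fix z
    show "cmod (scalar_product (vcnj w) z) \<le> norm w * (1 + norm z)"
      using norm_scalar_product_le[of "vcnj w" z] by (simp add: distrib_left add_increasing)
  qed simp
  have growth: "linear_growth q"
    unfolding q_def
    by (intro linear_growth_add lg1 linear_growth_cmult[OF linear_growth_scalar_product[OF b1]] linear_growth_cmult[OF lgw])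
  have "rho lam (heis x) (coherent lam w) z = exp (q x z)" for x z
  proof -
    obtain a c where x: "x = (a, c)" by (cases x)
    show ?thesis
      unfolding x rho_heis weyl_coherent
      unfolding coherent_def exp_add[symmetric] of_real_mult q_def q1_def scalar_product_vcnj_self
      by (rule arg_cong[of _ _ exp]) (simp add: field_simps)
  qed
  then have "exp_family q (\<lambda>x. rho lam (heis x) (coherent lam w))"
    unfolding exp_family_def by (intro exI[of _ "\<lambda>x z. 1"]) (auto simp: fun_eq_iff intro: poly_family.const)
  from exp_family_fock_Ck[OF lam poly growth this] show ?thesis
    by (simp add: smooth_vectors_def coherent_in_fock[OF lam])
qed

end

subsection \<open>The kernel of a unitary operator\<close>

context
  fixes lam :: real and T :: "(complex ^ 'n \<Rightarrow> complex) \<Rightarrow> complex ^ 'n \<Rightarrow> complex"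
  assumes lam: "lam > 0" and T: "fock_unitary lam T"
begin

lemma unitary_in_fock: "f \<in> fock lam \<Longrightarrow> T f \<in> fock lam"
  using T by (auto simp: fock_unitary_def)

lemma unitary_surj:
  assumes "g \<in> fock lam"
  shows "\<exists>f\<in>fock lam. T f = g"
proof -
  have "g \<in> T ` fock lam" using assms T by (simp add: fock_unitary_def)
  then show ?thesis by blast
qed

lemma unitary_inner: "f \<in> fock lam \<Longrightarrow> g \<in> fock lam \<Longrightarrow> fock_inner lam (T f) (T g) = fock_inner lam f g"
  using T by (simp add: fock_unitary_def)

lemma unitary_lincomb:
  "f \<in> fock lam \<Longrightarrow> g \<in> fock lam \<Longrightarrow> T (\<lambda>z. a * f z + b * g z) = (\<lambda>z. a * T f z + b * T g z)"
  using T by (simp add: fock_unitary_def)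

lemma unitary_scale: "f \<in> fock lam \<Longrightarrow> T (\<lambda>z. a * f z) = (\<lambda>z. a * T f z)"
  using unitary_lincomb[of f f a 0] by simp

lemma unitary_add: "f \<in> fock lam \<Longrightarrow> g \<in> fock lam \<Longrightarrow> T (\<lambda>z. f z + g z) = (\<lambda>z. T f z + T g z)"
  using unitary_lincomb[of f g 1 1] by simp

lemma unitary_diff: "f \<in> fock lam \<Longrightarrow> g \<in> fock lam \<Longrightarrow> T (\<lambda>z. f z - g z) = (\<lambda>z. T f z - T g z)"
  using unitary_lincomb[of f g 1 "-1"] by simp

lemma unitary_norm:
  assumes "f \<in> fock lam"
  shows "fock_norm lam (T f) = fock_norm lam f"
proof -
  have "complex_of_real ((fock_norm lam (T f))\<^sup>2) = complex_of_real ((fock_norm lam f)\<^sup>2)"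
    using unitary_inner[OF assms assms] by (simp only: fock_inner_self[OF lam] unitary_in_fock assms)
  then have "(fock_norm lam (T f))\<^sup>2 = (fock_norm lam f)\<^sup>2" by (simp only: of_real_eq_iff)
  then show ?thesis by (simp add: fock_norm_def)
qed

lemma unitary_curve_deriv:
  assumes \<psi>: "\<And>t. \<psi> t \<in> fock lam" and g: "g \<in> fock lam" and d: "fock_curve_deriv lam \<psi> g"
  shows "fock_curve_deriv lam (\<lambda>t. T (\<psi> t)) (T g)"
proof -
  have "fock_norm lam (\<lambda>z. T (\<psi> t) z - T (\<psi> 0) z - complex_of_real t * T g z)
      = fock_norm lam (\<lambda>z. \<psi> t z - \<psi> 0 z - complex_of_real t * g z)" for t
  proof -
    have "(\<lambda>z. T (\<psi> t) z - T (\<psi> 0) z - complex_of_real t * T g z)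
        = T (\<lambda>z. \<psi> t z - \<psi> 0 z - complex_of_real t * g z)"
      by (simp add: unitary_diff unitary_scale \<psi> g fock_diff[OF lam] fock_scale[OF lam])
    then show ?thesis
      by (simp add: unitary_norm \<psi> g fock_diff[OF lam] fock_scale[OF lam])
  qed
  then show ?thesis using d by (simp add: fock_curve_deriv_def)
qed

lemma kernel_eq:
  "integral_kernel lam T z w
     = of_real (measure (gauss lam :: (complex ^ 'n) measure) UNIV) * T (coherent lam w) z"
  unfolding integral_kernel_def
  by (rule fock_reproducing[OF lam unitary_in_fock[OF coherent_in_fock[OF lam]]])

text \<open>Both variables move at once, as the intertwining argument requires; setting one
  direction to 0 yields the partial derivatives.\<close>

lemma kernel_has_vector_derivative:
  "((\<lambda>t. integral_kernel lam T (z + t *\<^sub>R a) (w + t *\<^sub>R h)) has_vector_derivative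
     fock_inner lam (T (coherent_deriv lam w h)) (coherent lam z)
     + fock_inner lam (T (coherent lam w)) (coherent_deriv lam z a)) (at 0)"
  using fock_inner_has_vector_derivative[OF lam
      unitary_in_fock[OF coherent_in_fock[OF lam]] unitary_in_fock[OF coherent_deriv_in_fock[OF lam]]
      unitary_curve_deriv[OF coherent_in_fock[OF lam] coherent_deriv_in_fock[OF lam]
        fock_has_derivative_curve[OF lam coherent_has_derivative[OF lam]]]
      coherent_in_fock[OF lam] coherent_deriv_in_fock[OF lam]
      fock_has_derivative_curve[OF lam coherent_has_derivative[OF lam]], of w h z a]
  by (simp add: integral_kernel_def)

lemma kernel_deriv_z:
  "((\<lambda>t. integral_kernel lam T (z + t *\<^sub>R a) w) has_vector_derivative
     fock_inner lam (T (coherent lam w)) (coherent_deriv lam z a)) (at 0)"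
proof -
  have 0: "coherent_deriv lam w 0 = (\<lambda>z. 0 * coherent lam w z)" by (simp add: coherent_deriv_def)
  have "fock_inner lam (T (coherent_deriv lam w 0)) (coherent lam z) = 0"
    unfolding 0 by (simp only: unitary_scale coherent_in_fock[OF lam]) (simp add: fock_inner_def)
  then show ?thesis using kernel_has_vector_derivative[of z a w 0] by simp
qed

lemma kernel_deriv_w:
  "((\<lambda>t. integral_kernel lam T z (w + t *\<^sub>R h)) has_vector_derivative
     fock_inner lam (T (coherent_deriv lam w h)) (coherent lam z)) (at 0)"
proof -
  have "fock_inner lam (T (coherent lam w)) (coherent_deriv lam z 0) = 0"
    by (simp add: coherent_deriv_def fock_inner_def)
  then show ?thesis using kernel_has_vector_derivative[of z 0 w h] by simp
qed

lemma deriv_z_add: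
  "fock_inner lam (T (coherent lam w)) (coherent_deriv lam z (a + b))
    = fock_inner lam (T (coherent lam w)) (coherent_deriv lam z a)
      + fock_inner lam (T (coherent lam w)) (coherent_deriv lam z b)"
proof -
  have "fock_inner lam (coherent_deriv lam z (a + b)) (T (coherent lam w))
    = fock_inner lam (coherent_deriv lam z a) (T (coherent lam w))
      + fock_inner lam (coherent_deriv lam z b) (T (coherent lam w))"
    unfolding coherent_deriv_add
    by (intro fock_inner_add_left[OF lam] coherent_deriv_in_fock[OF lam] unitary_in_fock coherent_in_fock[OF lam])
  from arg_cong[OF this, of cnj] show ?thesis
    by (simp add: fock_inner_cnj[symmetric])
qed

lemma deriv_z_scale:
  "fock_inner lam (T (coherent lam w)) (coherent_deriv lam z (c *s a))
    = c * fock_inner lam (T (coherent lam w)) (coherent_deriv lam z a)"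
  unfolding coherent_deriv_scale
  by (simp add: fock_inner_scale_right[OF lam] coherent_deriv_in_fock[OF lam] unitary_in_fock coherent_in_fock[OF lam])

lemma deriv_w_add:
  "fock_inner lam (T (coherent_deriv lam w (a + b))) (coherent lam z)
    = fock_inner lam (T (coherent_deriv lam w a)) (coherent lam z)
      + fock_inner lam (T (coherent_deriv lam w b)) (coherent lam z)"
  unfolding coherent_deriv_add unitary_add[OF coherent_deriv_in_fock[OF lam] coherent_deriv_in_fock[OF lam]]
  by (intro fock_inner_add_left[OF lam] coherent_deriv_in_fock[OF lam] unitary_in_fock coherent_in_fock[OF lam])

lemma deriv_w_scale:
  "fock_inner lam (T (coherent_deriv lam w (c *s a))) (coherent lam z)
    = cnj c * fock_inner lam (T (coherent_deriv lam w a)) (coherent lam z)"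
  unfolding coherent_deriv_scale unitary_scale[OF coherent_deriv_in_fock[OF lam]]
  by (intro fock_inner_scale_left[OF lam] coherent_deriv_in_fock[OF lam] unitary_in_fock coherent_in_fock[OF lam])

lemma axis_imaginary: "axis j \<i> = \<i> *s axis j (1 :: complex)"
  by (simp add: vec_eq_iff axis_def)

text \<open>The antilinearity of \<open>coherent_deriv\<close> and that of the second slot of the
  inner product cancel. The directional derivative is thus complex-linear in a and agrees with the
  Wirtinger expression.\<close>

lemma kernel_wirtinger:
  "(\<Sum>j\<in>UNIV. a $ j * wirtinger j (\<lambda>z'. integral_kernel lam T z' w) z)
    = fock_inner lam (T (coherent lam w)) (coherent_deriv lam z a)"
proof -
  have "wirtinger j (\<lambda>z'. integral_kernel lam T z' w) z
      = fock_inner lam (T (coherent lam w)) (coherent_deriv lam z (axis j 1))" for j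
    unfolding wirtinger_def partial_re_def partial_im_def
      kernel_deriv_z[THEN vector_derivative_at] axis_imaginary deriv_z_scale
    by (simp add: complex_eq_iff)
  then show ?thesis
    using additive_homogeneous_expand[of "\<lambda>a. fock_inner lam (T (coherent lam w)) (coherent_deriv lam z a)" a]
    by (simp add: deriv_z_add deriv_z_scale)
qed

text \<open>Here \<open>coherent_deriv\<close> sits in the linear slot, so the directional
  derivative is antilinear in its direction; feeding it the conjugate of v restores linearity in
  v.\<close>

lemma kernel_wirtinger_bar:
  "(\<Sum>j\<in>UNIV. v $ j * wirtinger_bar j (\<lambda>w'. integral_kernel lam T z w') w)
    = fock_inner lam (T (coherent_deriv lam w (vcnj v))) (coherent lam z)"
proof -
  have eq: "wirtinger_bar j (\<lambda>w'. integral_kernel lam T z w') w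
      = fock_inner lam (T (coherent_deriv lam w (vcnj (axis j 1)))) (coherent lam z)" for j
  proof -
    have "vcnj (axis j (1 :: complex)) = axis j 1" by (simp add: vec_eq_iff axis_def)
    then show ?thesis
      unfolding wirtinger_bar_def partial_re_def partial_im_def
        kernel_deriv_w[THEN vector_derivative_at] axis_imaginary deriv_w_scale
      by (simp add: complex_eq_iff)
  qed
  show ?thesis
    using additive_homogeneous_expand[of "\<lambda>v. fock_inner lam (T (coherent_deriv lam w (vcnj v))) (coherent lam z)" v]
    by (simp add: deriv_w_add deriv_w_scale eq)
qed

end

section \<open>From the kernel equation to the intertwining of one-parameter groups\<close>

lemma real_form_span:
  fixes E :: "complex ^ 'n \<Rightarrow> complex ^ 'n \<Rightarrow> complex"
  assumes add: "\<And>u v u' v'. E (u + u') (v + v') = E u v + E u' v'"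
    and scale: "\<And>c u v. E (c *s u) (c *s v) = c * E u v"
    and zero: "\<And>a. E a (vcnj a) = 0"
  shows "E u v = 0"
proof -
  \<comment> \<open>Decomposition of (u, v) as X + iY with X and Y in the real form v = cnj u, where
    b = (u - cnj v) / (2i).\<close>
  define a where "a = (1 / 2) *s (u + vcnj v)"
  define b where "b = (- \<i> / 2) *s (u - vcnj v)"
  have "u = a + \<i> *s b" "v = vcnj a + \<i> *s vcnj b"
    by (simp_all add: a_def b_def vec_eq_iff complex_eq_iff field_simps)
  then have "E u v = E a (vcnj a) + \<i> * E b (vcnj b)"
    by (metis add scale)
  then show ?thesis by (simp add: zero)
qed

text \<open>With \<open>\<phi>(t) = \<langle>T (weyl (t a) e\<^sub>w), weyl (t b) e\<^sub>z\<rangle>\<close>, the assumption says \<open>\<phi>'(0) = 0\<close> for all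
  \<open>z, w\<close>. Weyl operators map coherent states to multiples of coherent states, so \<open>\<phi>'\<close> vanishes
  everywhere.\<close>

lemma intertwining_coherent:
  fixes T :: "(complex ^ 'n \<Rightarrow> complex) \<Rightarrow> complex ^ 'n \<Rightarrow> complex"
  assumes lam: "lam > 0" and T: "fock_unitary lam T"
    and pde: "\<And>z w. complex_of_real lam / 2 * scalar_product (vcnj b) z * integral_kernel lam T z w
        - fock_inner lam (T (coherent lam w)) (coherent_deriv lam z b)
      = - (complex_of_real lam / 2) * scalar_product a (vcnj w) * integral_kernel lam T z w
        + fock_inner lam (T (coherent_deriv lam w a)) (coherent lam z)"
  shows "T (weyl lam (t *\<^sub>R a) (coherent lam w)) = weyl lam (t *\<^sub>R b) (T (coherent lam w))"
proof -
  note infock = coherent_in_fock[OF lam] weyl_in_fock[OF lam] unitary_in_fock[OF lam T] fock_scale[OF lam]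
  define \<phi> where "\<phi> = (\<lambda>z w t. fock_inner lam (T (weyl lam (t *\<^sub>R a) (coherent lam w))) (weyl lam (t *\<^sub>R b) (coherent lam z)))"
  define \<alpha> where "\<alpha> = (\<lambda>(u :: complex ^ 'n) w t. exp (- complex_of_real (lam / 4 * (norm (t *\<^sub>R u))\<^sup>2)
     - complex_of_real lam / 2 * scalar_product (vcnj w) (t *\<^sub>R u)))"
  have weyl: "weyl lam (t *\<^sub>R u) (coherent lam w) = (\<lambda>z. \<alpha> u w t * coherent lam (w + t *\<^sub>R u) z)" for t u w
    by (simp only: weyl_coherent \<alpha>_def)
  have \<alpha>: "(\<alpha> u w has_vector_derivative - (complex_of_real lam / 2 * scalar_product (vcnj w) u)) (at 0)" for u w
  proof -
    have "\<alpha> u w = (\<lambda>t. exp (- (complex_of_real lam / 2 * scalar_product (vcnj w) u) * complex_of_real t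
        + (- complex_of_real (lam / 4 * (norm u)\<^sup>2)) * (complex_of_real t)\<^sup>2))"
      unfolding \<alpha>_def by (rule ext, rule arg_cong[of _ _ exp]) (simp add: power_mult_distrib mult_ac)
    then show ?thesis by (simp only: has_vector_derivative_exp_quadratic)
  qed
  have \<alpha>0: "\<alpha> u w 0 = 1" for u w by (simp add: \<alpha>_def)
  have \<alpha>_nz: "\<alpha> u w t \<noteq> 0" for u w t by (simp add: \<alpha>_def)
  have inner_scaled: "fock_inner lam (T (\<lambda>z. c * f z)) (\<lambda>z. d * g z) = c * (cnj d * fock_inner lam (T f) g)"
    if "f \<in> fock lam" "g \<in> fock lam" for c d f g
    using that by (simp add: unitary_scale[OF lam T] fock_inner_scale_left[OF lam] fock_inner_scale_right[OF lam] infock)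
  have \<phi>_kernel: "\<phi> z w t = \<alpha> a w t * (cnj (\<alpha> b z t) * integral_kernel lam T (z + t *\<^sub>R b) (w + t *\<^sub>R a))" for z w t
    unfolding \<phi>_def weyl integral_kernel_def by (intro inner_scaled infock)
  have \<phi>0: "(\<phi> z w has_vector_derivative 0) (at 0)" for z w
  proof -
    have "((\<lambda>t. \<alpha> a w t * (cnj (\<alpha> b z t) * integral_kernel lam T (z + t *\<^sub>R b) (w + t *\<^sub>R a))) has_vector_derivative
      \<alpha> a w 0 * (cnj (\<alpha> b z 0) * (fock_inner lam (T (coherent_deriv lam w a)) (coherent lam z)
             + fock_inner lam (T (coherent lam w)) (coherent_deriv lam z b))
           + cnj (- (complex_of_real lam / 2 * scalar_product (vcnj z) b)) * integral_kernel lam T (z + 0 *\<^sub>R b) (w + 0 *\<^sub>R a))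
       + - (complex_of_real lam / 2 * scalar_product (vcnj w) a)
           * (cnj (\<alpha> b z 0) * integral_kernel lam T (z + 0 *\<^sub>R b) (w + 0 *\<^sub>R a))) (at 0)"
      by (intro has_vector_derivative_mult \<alpha> has_vector_derivative_cnj kernel_has_vector_derivative[OF lam T])
    moreover have "\<alpha> a w 0 * (cnj (\<alpha> b z 0) * (fock_inner lam (T (coherent_deriv lam w a)) (coherent lam z)
             + fock_inner lam (T (coherent lam w)) (coherent_deriv lam z b))
           + cnj (- (complex_of_real lam / 2 * scalar_product (vcnj z) b)) * integral_kernel lam T (z + 0 *\<^sub>R b) (w + 0 *\<^sub>R a))
       + - (complex_of_real lam / 2 * scalar_product (vcnj w) a)
           * (cnj (\<alpha> b z 0) * integral_kernel lam T (z + 0 *\<^sub>R b) (w + 0 *\<^sub>R a)) = 0"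
      using pde[of z w] by (simp add: \<alpha>0 scalar_product_commute algebra_simps)
    moreover have "\<phi> z w = (\<lambda>t. \<alpha> a w t * (cnj (\<alpha> b z t) * integral_kernel lam T (z + t *\<^sub>R b) (w + t *\<^sub>R a)))"
      by (rule ext) (rule \<phi>_kernel)
    ultimately show ?thesis by metis
  qed
  have \<phi>_shift: "\<phi> z w (s + t) = \<alpha> a w t * (cnj (\<alpha> b z t) * \<phi> (z + t *\<^sub>R b) (w + t *\<^sub>R a) s)" for z w s t
    unfolding \<phi>_def weyl_scaleR_add unfolding weyl[of t] weyl_scale by (intro inner_scaled infock)
  have \<phi>_deriv: "(\<phi> z w has_derivative (\<lambda>h. 0)) (at t)" for z w t
  proof -
    \<comment> \<open>The base point 0 appears as t - t so that composition with r - t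
      applies.\<close>
    have "((\<lambda>s. \<alpha> a w t * (cnj (\<alpha> b z t) * \<phi> (z + t *\<^sub>R b) (w + t *\<^sub>R a) s)) has_derivative (\<lambda>h. 0)) (at (t - t))"
      using has_vector_derivative_mult_right[OF has_vector_derivative_mult_right[OF \<phi>0]]
      by (simp add: has_vector_derivative_def)
    moreover have "((\<lambda>r. r - t) has_derivative (\<lambda>h. h)) (at t)"
      by (auto intro!: derivative_eq_intros)
    ultimately have "((\<lambda>r. \<phi> z w ((r - t) + t)) has_derivative (\<lambda>h. 0)) (at t)"
      unfolding \<phi>_shift by (rule has_derivative_compose[rotated])
    then show ?thesis by simp
  qed
  have "\<phi> z w t = \<phi> z w 0" for z
  proof -
    obtain c where "\<And>x. \<phi> z w x = c"
      using has_derivative_zero_constant[OF convex_UNIV has_derivative_at_withinI[OF \<phi>_deriv[of z w]]] by auto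
    then show ?thesis by simp
  qed
  \<comment> \<open>The value at 0 is the inner product of T applied to one coherent state with
    another; the isometry \<open>weyl lam (t *\<^sub>R b)\<close> is applied to both of its
    entries.\<close>
  then have "fock_inner lam (T (weyl lam (t *\<^sub>R a) (coherent lam w))) (weyl lam (t *\<^sub>R b) (coherent lam z))
      = fock_inner lam (weyl lam (t *\<^sub>R b) (T (coherent lam w))) (weyl lam (t *\<^sub>R b) (coherent lam z))" for z
    by (simp add: weyl_inner[OF lam] infock \<phi>_def)
  then have eq: "fock_inner lam (T (weyl lam (t *\<^sub>R a) (coherent lam w))) (coherent lam (z + t *\<^sub>R b))
      = fock_inner lam (weyl lam (t *\<^sub>R b) (T (coherent lam w))) (coherent lam (z + t *\<^sub>R b))" for z
    by (simp add: weyl[of t b] fock_inner_scale_right[OF lam] infock \<alpha>_nz)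
  show ?thesis
  proof (rule fock_eqI[OF lam])
    fix y
    show "fock_inner lam (T (weyl lam (t *\<^sub>R a) (coherent lam w))) (coherent lam y)
      = fock_inner lam (weyl lam (t *\<^sub>R b) (T (coherent lam w))) (coherent lam y)"
      \<comment> \<open>The labels z + t b exhaust the whole space.\<close>
      using eq[of "y - t *\<^sub>R b"] by simp
  qed (intro infock)+
qed

text \<open>Surjectivity provides a preimage g of \<open>weyl lam b (T f)\<close>. Unitarity moves
  its inner products with Weyl-translated coherent states back to those of
  \<open>weyl lam a f\<close>, and these states are multiples of all coherent states.\<close>

lemma intertwining_fock:
  fixes T :: "(complex ^ 'n \<Rightarrow> complex) \<Rightarrow> complex ^ 'n \<Rightarrow> complex"
  assumes lam: "lam > 0" and T: "fock_unitary lam T"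
    and coh: "\<And>w. T (weyl lam a (coherent lam w)) = weyl lam b (T (coherent lam w))"
    and f: "f \<in> fock lam"
  shows "T (weyl lam a f) = weyl lam b (T f)"
proof -
  note infock = coherent_in_fock[OF lam] weyl_in_fock[OF lam] unitary_in_fock[OF lam T]
  obtain g where g: "g \<in> fock lam" "T g = weyl lam b (T f)"
    using unitary_surj[OF lam T, of "weyl lam b (T f)"] infock f by blast
  have eq: "fock_inner lam g (weyl lam a (coherent lam w)) = fock_inner lam (weyl lam a f) (weyl lam a (coherent lam w))" for w
  proof -
    have "fock_inner lam g (weyl lam a (coherent lam w)) = fock_inner lam (T g) (T (weyl lam a (coherent lam w)))"
      by (intro unitary_inner[OF lam T, symmetric] infock g)
    also have "\<dots> = fock_inner lam (T f) (T (coherent lam w))"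
      unfolding coh g(2) by (intro weyl_inner[OF lam] infock f)
    also have "\<dots> = fock_inner lam f (coherent lam w)"
      by (intro unitary_inner[OF lam T] infock f)
    also have "\<dots> = fock_inner lam (weyl lam a f) (weyl lam a (coherent lam w))"
      by (intro weyl_inner[OF lam, symmetric] infock f)
    finally show ?thesis .
  qed
  have "g = weyl lam a f"
  proof (rule fock_eqI[OF lam])
    fix y
    show "fock_inner lam g (coherent lam y) = fock_inner lam (weyl lam a f) (coherent lam y)"
      using eq[of "y - a"]
      by (simp add: weyl_coherent fock_inner_scale_right[OF lam] infock f g)
  qed (intro infock f g)+
  then show ?thesis using g by simp
qed

theorem proposition3p1:
  fixes lam :: real
    and A B C D :: "complex ^ 'n ^ 'n"
    and k :: "complex ^ ('n + 'n) ^ ('n + 'n)"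
    and Ak :: "(complex ^ 'n \<Rightarrow> complex) \<Rightarrow> (complex ^ 'n \<Rightarrow> complex)"
    and bk :: "complex ^ 'n \<Rightarrow> complex ^ 'n \<Rightarrow> complex"
  assumes lam: "lam > 0"
    and k: "k = block_matrix A B C D" "k \<in> S_group"
    and Ak: "fock_unitary lam Ak"
    and bk: "bk = integral_kernel lam Ak"
  shows
    "(\<forall>X\<in>heis_lie. \<forall>f\<in>smooth_vectors lam.
        drho lam (act k X) (Ak f) = Ak (drho lam X f))
     \<longleftrightarrow>
     (\<forall>u v z w :: complex ^ 'n.
        complex_of_real lam / 2 * scalar_product (C *v u + D *v v) z * bk z w
          - (\<Sum>j\<in>UNIV. (A *v u + B *v v) $ j * wirtinger j (\<lambda>z'. bk z' w) z)
        = - (complex_of_real lam / 2) * scalar_product u (vcnj w) * bk z w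
          + (\<Sum>j\<in>UNIV. v $ j * wirtinger_bar j (\<lambda>w'. bk z w') w))"
    (is "?rel \<longleftrightarrow> ?pde")
proof -
  note infock = coherent_in_fock[OF lam] weyl_in_fock[OF lam] unitary_in_fock[OF lam Ak] fock_scale[OF lam]
  define N where "N = complex_of_real (measure (gauss lam :: (complex ^ 'n) measure) UNIV)"
  have bN: "bk z w = N * Ak (coherent lam w) z" for z w
    unfolding bk N_def by (rule kernel_eq[OF lam Ak])
  define dz where "dz = (\<lambda>z w a. fock_inner lam (Ak (coherent lam w)) (coherent_deriv lam z a))"
  define dw where "dw = (\<lambda>z w h. fock_inner lam (Ak (coherent_deriv lam w h)) (coherent lam z))"
  have wz: "(\<Sum>j\<in>UNIV. a $ j * wirtinger j (\<lambda>z'. bk z' w) z) = dz z w a" for a z w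
    unfolding bk dz_def by (rule kernel_wirtinger[OF lam Ak])
  have ww: "(\<Sum>j\<in>UNIV. v $ j * wirtinger_bar j (\<lambda>w'. bk z w') w) = dw z w (vcnj v)" for v z w
    unfolding bk dw_def by (rule kernel_wirtinger_bar[OF lam Ak])
  \<comment> \<open>The difference of the two sides, with derivatives of the kernel replaced by
    inner products. It is complex-linear in (u, v), as \<open>dw\<close> is antilinear in its
    direction and receives the conjugate of v.\<close>
  define E where "E = (\<lambda>z w u v. complex_of_real lam / 2 * scalar_product (C *v u + D *v v) z * bk z w
      - dz z w (A *v u + B *v v) + complex_of_real lam / 2 * scalar_product u (vcnj w) * bk z w - dw z w (vcnj v))"
  have pde_iff: "?pde \<longleftrightarrow> (\<forall>u v z w. E z w u v = 0)"
    unfolding wz ww E_def by (simp add: algebra_simps)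
  have E_real: "E z w u v = 0" if "\<And>a. E z w a (vcnj a) = 0" for z w u v
  proof (rule real_form_span[of "E z w", OF _ _ that])
    have dz: "dz z w (x + y) = dz z w x + dz z w y" "dz z w (c *s x) = c * dz z w x" for x y c
      unfolding dz_def by (rule deriv_z_add[OF lam Ak], rule deriv_z_scale[OF lam Ak])
    have dw: "dw z w (x + y) = dw z w x + dw z w y" "dw z w (c *s x) = cnj c * dw z w x" for x y c
      unfolding dw_def by (rule deriv_w_add[OF lam Ak], rule deriv_w_scale[OF lam Ak])
    show "E z w (u + u') (v + v') = E z w u v + E z w u' v'" for u v u' v'
      by (simp add: E_def dz dw matrix_vector_right_distrib algebra_simps add_divide_distrib)
    show "E z w (c *s u) (c *s v) = c * E z w u v" for c u v
      by (simp add: E_def dz dw vector_scalar_commute algebra_simps)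
  qed
  have act: "act k ((u, v), c) = ((A *v u + B *v v, C *v u + D *v v), c)" for u v c
    unfolding k(1) by (rule act_block_matrix)
  have conj: "vcnj (A *v a + B *v vcnj a) = C *v a + D *v vcnj a" for a
    using S_group_blocks k by blast
  show ?thesis
  proof
    assume rel: ?rel
    have "E z w a (vcnj a) = 0" for z w a
    proof -
      define F where "F = Ak (coherent lam w)"
      have F: "holomorphic_Cn F" unfolding F_def by (rule fock_holomorphic[OF infock(3)[OF infock(1)]])
      have "((a, vcnj a), 0) \<in> heis_lie"
        by (auto simp: heis_lie_def intro!: exI[of _ a] exI[of _ "0::real"])
      then have "drho lam (act k ((a, vcnj a), 0)) F = Ak (drho lam ((a, vcnj a), 0) (coherent lam w))"
        using rel coherent_smooth[OF lam, of w] unfolding F_def by blast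
      \<comment> \<open>On a coherent state the Lie algebra acts as the derivative in w minus a
        multiple of the state. Both pieces lie in the Fock space, so linearity of \<open>Ak\<close>
        applies.\<close>
      moreover have "Ak (drho lam ((a, vcnj a), 0) (coherent lam w))
          = (\<lambda>z. Ak (coherent_deriv lam w a) z - complex_of_real lam / 2 * scalar_product a (vcnj w) * F z)"
      proof -
        have "drho lam ((a, vcnj a), 0) (coherent lam w)
           = (\<lambda>z. coherent_deriv lam w a z - (complex_of_real lam / 2 * scalar_product a (vcnj w)) * coherent lam w z)"
          by (simp add: fun_eq_iff drho_coherent coherent_deriv_def)
        then show ?thesis
          unfolding F_def
          by (simp only: unitary_diff[OF lam Ak coherent_deriv_in_fock[OF lam] fock_scale[OF lam coherent_in_fock[OF lam]]]
              unitary_scale[OF lam Ak coherent_in_fock[OF lam]])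
      qed
      \<comment> \<open>Multiplying by N converts values of functions into kernel values and inner
        products with \<open>coherent lam z\<close>.\<close>
      ultimately have "N * drho lam (act k ((a, vcnj a), 0)) F z
         = N * (Ak (coherent_deriv lam w a) z - complex_of_real lam / 2 * scalar_product a (vcnj w) * F z)"
        by simp
      moreover have "N * Ak (coherent_deriv lam w a) z = dw z w a"
        unfolding N_def dw_def
        by (rule fock_reproducing[OF lam unitary_in_fock[OF lam Ak coherent_deriv_in_fock[OF lam]], symmetric])
      moreover have "dz z w (A *v a + B *v vcnj a)
          = N * (\<Sum>j\<in>UNIV. (A *v a + B *v vcnj a) $ j * wirtinger j F z)"
        unfolding wz[symmetric] bN F_def[symmetric] wirtinger_cmult[OF F] by (simp add: sum_distrib_left mult_ac)
      ultimately show ?thesis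
        unfolding E_def bN F_def[symmetric] by (simp add: act drho_def algebra_simps add_divide_distrib)
    qed
    then show ?pde unfolding pde_iff using E_real by blast
  next
    assume ?pde
    then have E0: "E z w u v = 0" for z w u v unfolding pde_iff by blast
    show ?rel
    proof (intro ballI)
      fix X :: "'n heis_lie_c" and f :: "complex ^ 'n \<Rightarrow> complex"
      assume "X \<in> heis_lie" and f: "f \<in> smooth_vectors lam"
      then obtain a c where X: "X = ((a, vcnj a), complex_of_real c)" by (auto simp: heis_lie_def)
      \<comment> \<open>By \<open>conj\<close>, \<open>act k X\<close> has the vector part (b, cnj
        b).\<close>
      define b where "b = A *v a + B *v vcnj a"
      have ff: "f \<in> fock lam" using f by (simp add: smooth_vectors_def)
      have intertwine: "Ak (weyl lam (t *\<^sub>R a) f) = weyl lam (t *\<^sub>R b) (Ak f)" for t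
      proof (rule intertwining_fock[OF lam Ak intertwining_coherent[OF lam Ak] ff])
        fix z w
        show "complex_of_real lam / 2 * scalar_product (vcnj b) z * integral_kernel lam Ak z w
            - fock_inner lam (Ak (coherent lam w)) (coherent_deriv lam z b)
          = - (complex_of_real lam / 2) * scalar_product a (vcnj w) * integral_kernel lam Ak z w
            + fock_inner lam (Ak (coherent_deriv lam w a)) (coherent lam z)"
          using E0[of z w a "vcnj a"] unfolding b_def conj
          by (simp add: E_def dz_def dw_def bk[symmetric] algebra_simps)
      qed
      have "fock_Ck lam (Suc 0) (\<lambda>x. rho lam (heis x) f)"
        using f by (simp add: smooth_vectors_def del: fock_Ck.simps)
      then obtain D where D: "\<And>x. fock_has_derivative lam (\<lambda>x. rho lam (heis x) f) (D x) x" by auto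
      define g where "g = D 0 (a, 0)"
      have gf: "g \<in> fock lam" using D[of 0] by (simp add: g_def fock_has_derivative_def)
      have "(\<lambda>t. rho lam (heis (0 + t *\<^sub>R (a, 0))) f) = (\<lambda>t. weyl lam (t *\<^sub>R a) f)"
        by (auto simp: fun_eq_iff rho_heis)
      then have cd: "fock_curve_deriv lam (\<lambda>t. weyl lam (t *\<^sub>R a) f) g"
        using fock_has_derivative_curve[OF lam D[of 0], of "(a, 0)"] by (simp add: g_def)
      \<comment> \<open>The norm derivative of the orbit is identified pointwise. In particular
        \<open>drho lam ((a, vcnj a), 0) f\<close> belongs to the Fock space, where
        \<open>Ak\<close> is linear and isometric.\<close>
      have g: "g = drho lam ((a, vcnj a), 0) f"
      proof
        fix z
        show "g z = drho lam ((a, vcnj a), 0) f z"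
          by (rule vector_derivative_unique_at[OF
                fock_curve_deriv_pointwise[OF lam weyl_in_fock[OF lam ff] gf cd]
                weyl_has_vector_derivative[OF fock_holomorphic[OF ff]]])
      qed
      \<comment> \<open>One curve, two derivatives: as the image under \<open>Ak\<close> of the
        orbit of f it has derivative \<open>Ak g\<close>, and as the Weyl orbit of the holomorphic
        function \<open>Ak f\<close> it is differentiated by \<open>drho\<close>.\<close>
      have Ag: "Ak g = drho lam ((b, vcnj b), 0) (Ak f)"
      proof
        fix z
        have "((\<lambda>t. Ak (weyl lam (t *\<^sub>R a) f) z) has_vector_derivative Ak g z) (at 0)"
          by (intro fock_curve_deriv_pointwise[OF lam] unitary_curve_deriv[OF lam Ak] infock ff gf cd)
        then show "Ak g z = drho lam ((b, vcnj b), 0) (Ak f) z"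
          unfolding intertwine
          by (rule vector_derivative_unique_at[OF _
                weyl_has_vector_derivative[OF fock_holomorphic[OF infock(3)[OF ff]]]])
      qed
      have "drho lam (act k X) (Ak f) = drho lam ((b, vcnj b), complex_of_real c) (Ak f)"
        unfolding X act b_def conj ..
      also have "\<dots> = (\<lambda>z. (\<i> * complex_of_real lam * complex_of_real c) * Ak f z + 1 * Ak g z)"
        unfolding Ag by (rule drho_central)
      also have "\<dots> = Ak (\<lambda>z. (\<i> * complex_of_real lam * complex_of_real c) * f z + 1 * g z)"
        by (rule unitary_lincomb[OF lam Ak ff gf, symmetric])
      also have "\<dots> = Ak (drho lam X f)"
        unfolding X g by (simp only: drho_central[of lam a "vcnj a" "complex_of_real c"])
      finally show "drho lam (act k X) (Ak f) = Ak (drho lam X f)" .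
    qed
  qed
qed

end
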